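(* Let $\varepsilon>0$ be sufficiently small, let $\alpha\ge1500\varepsilon^{-2}$, let $G$ be an $\alpha$-pseudo-random graph on $[n]$, let $v_0\in[n]$, let $L_2=(2+\varepsilon)n\ln n$, and let $\Gamma=\Gamma^{v_0}_{L_2}(G)$ be the trace of a $\frac12$-lazy simple random walk of length $L_2$ on $G$ starting at $v_0$. Then there exists $\beta>0$ such that with high probability, every set $A\subseteq[n]$ with $|A|=a\le n/\ln n$ satisfies $|N_\Gamma(A)|\ge\beta a\ln n$.
   Context: A graph $G$ on $[n]$ is $\alpha$-pseudo-random (for $\alpha=\alpha(n)>0$) if: (P1) $G$ is connected; (P2) for every $v$, $|d(v)-\alpha\ln n|\le2\sqrt\alpha\ln n$ and $\frac{5\alpha}{6}\ln n\le d(v)\le\frac{4\alpha}{3}\ln n$; (P3) for every non-empty $S\subseteq[n]$ with $|S|\le0.8n$, $|\partial S|>\frac{|S||S^c|\alpha\ln n}{2n}$; (P4) for every large enough constant $K>0$ and every non-empty $A$ with $|A|=a$: if $\frac n{\alpha\ln n}\le a\le\frac n{\ln n}$ then $|E(A,\{u\in N(A):|E(u,A)|\ge Ka\alpha\ln n/n\})|\le a\alpha\ln n/K$, and if $a<\frac n{\alpha\ln n}$ then $|E(A,\{u\in N(A):|E(u,A)|\ge K\})|\le a\alpha\ln n/\ln K$; (P5) for every $A$ with $|A|=n(\ln\ln n)^{1.5}/\ln n$ at most $|A|/2$ vertices $v\notin A$ have $|E(v,A)|\le\alpha(\ln\ln n)^{1.5}/2$; (P6) if $\alpha<\ln^2n$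 then for every $v$, every $0\le r\le\frac{\ln n}{15\ln\ln n}$ and every $w\in N(v,r)$, $|E(w,B(v,r))|\le5$. Here $E(A,B)$ is the set of edges between $A$ and $B$, $N(A)$ the external neighbourhood, $\partial S$ the edge boundary, $B(v,r)$ the ball of radius $r$ around $v$ in graph distance, $N(v,r)=B(v,r)\setminus B(v,r-1)$. A $\frac12$-lazy random walk stays put with probability $1/2$ at each step and otherwise moves to a uniformly random neighbour. The trace is the multigraph on $[n]$ of traversed edges; $N_\Gamma(A)$ is the set of vertices outside $A$ with a $\Gamma$-neighbour in $A$. "With high probability" means with probability tending to $1$ as $n\to\infty$. *)

theory Defs
  imports "HOL-Probability.Probability"
begin

text \<open>
  A simple graph on the vertex set \<open>{1..n}\<close> is represented by its set of edges, each edge being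
  a two-element set of vertices.
\<close>

type_synonym graph = "nat set set"

definition graph_on :: "nat \<Rightarrow> graph \<Rightarrow> bool" where
  "graph_on n G \<longleftrightarrow> (\<forall>e\<in>G. e \<subseteq> {1..n} \<and> card e = 2)"

definition adj :: "graph \<Rightarrow> (nat \<times> nat) set" where
  "adj G = {(u, v). {u, v} \<in> G}"

definition neighbours :: "graph \<Rightarrow> nat \<Rightarrow> nat set" where
  "neighbours G v = {u. (v, u) \<in> adj G}"

definition deg :: "graph \<Rightarrow> nat \<Rightarrow> nat" where
  "deg G v = card (neighbours G v)"

definition edges_between :: "graph \<Rightarrow> nat set \<Rightarrow> nat set \<Rightarrow> nat set set" where
  "edges_between G A B = {e \<in> G. \<exists>x\<in>A. \<exists>y\<in>B. e = {x, y}}"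

definition ext_nbhd :: "graph \<Rightarrow> nat set \<Rightarrow> nat set" where
  "ext_nbhd G A = {u. u \<notin> A \<and> (\<exists>v\<in>A. (u, v) \<in> adj G)}"

definition graph_connected :: "nat \<Rightarrow> graph \<Rightarrow> bool" where
  "graph_connected n G \<longleftrightarrow> (\<forall>u\<in>{1..n}. \<forall>v\<in>{1..n}. (u, v) \<in> (adj G)\<^sup>*)"

definition graph_dist :: "graph \<Rightarrow> nat \<Rightarrow> nat \<Rightarrow> enat" where
  "graph_dist G u v = (INF k\<in>{k. (u, v) \<in> adj G ^^ k}. enat k)"

definition gball :: "graph \<Rightarrow> nat \<Rightarrow> nat \<Rightarrow> nat set" where
  "gball G v r = {w. graph_dist G v w \<le> enat r}"

text \<open>The set \<open>N(v,r)\<close>, with the convention that the ball of radius \<open>-1\<close> is empty.\<close>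

definition gsphere :: "graph \<Rightarrow> nat \<Rightarrow> nat \<Rightarrow> nat set" where
  "gsphere G v r = gball G v r - (if r = 0 then {} else gball G v (r - 1))"

definition degree_cond :: "real \<Rightarrow> nat \<Rightarrow> graph \<Rightarrow> bool" where
  "degree_cond a n G \<longleftrightarrow>
     (\<forall>v\<in>{1..n}.
        \<bar>real (deg G v) - a * ln (real n)\<bar> \<le> 2 * sqrt a * ln (real n) \<and>
        5 * a / 6 * ln (real n) \<le> real (deg G v) \<and>
        real (deg G v) \<le> 4 * a / 3 * ln (real n))"

definition boundary_cond :: "real \<Rightarrow> nat \<Rightarrow> graph \<Rightarrow> bool" where
  "boundary_cond a n G \<longleftrightarrow>
     (\<forall>S. S \<subseteq> {1..n} \<longrightarrow> S \<noteq> {} \<longrightarrow> real (card S) \<le> 0.8 * real n \<longrightarrow>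
        real (card (edges_between G S ({1..n} - S)))
          > real (card S) * real (card ({1..n} - S)) * a * ln (real n) / (2 * real n))"

text \<open>The condition on edges into vertices of large codegree, for one given constant \<open>K\<close>.\<close>

definition codegree_cond :: "real \<Rightarrow> real \<Rightarrow> nat \<Rightarrow> graph \<Rightarrow> bool" where
  "codegree_cond K a n G \<longleftrightarrow>
     (\<forall>A. A \<subseteq> {1..n} \<longrightarrow> A \<noteq> {} \<longrightarrow>
        (real n / (a * ln (real n)) \<le> real (card A) \<and> real (card A) \<le> real n / ln (real n) \<longrightarrow>
           real (card (edges_between G A
             {u \<in> ext_nbhd G A. real (card (edges_between G {u} A))
                                  \<ge> K * real (card A) * a * ln (real n) / real n}))
             \<le> real (card A) * a * ln (real n) / K) \<and>
        (real (card A) < real n / (a * ln (real n)) \<longrightarrow>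
           real (card (edges_between G A
             {u \<in> ext_nbhd G A. real (card (edges_between G {u} A)) \<ge> K}))
             \<le> real (card A) * a * ln (real n) / ln K))"

text \<open>
  The size \<open>n (ln ln n)^1.5 / ln n\<close> is in general not an integer, so it is rounded down here.
\<close>

definition medium_set_cond :: "real \<Rightarrow> nat \<Rightarrow> graph \<Rightarrow> bool" where
  "medium_set_cond a n G \<longleftrightarrow>
     (\<forall>A. A \<subseteq> {1..n} \<longrightarrow>
        int (card A) = \<lfloor>real n * ln (ln (real n)) powr 1.5 / ln (real n)\<rfloor> \<longrightarrow>
        real (card {v \<in> {1..n} - A.
            real (card (edges_between G {v} A)) \<le> a * ln (ln (real n)) powr 1.5 / 2})
          \<le> real (card A) / 2)"

definition local_sparsity_cond :: "real \<Rightarrow> nat \<Rightarrow> graph \<Rightarrow> bool" where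
  "local_sparsity_cond a n G \<longleftrightarrow>
     (a < (ln (real n))\<^sup>2 \<longrightarrow>
        (\<forall>v\<in>{1..n}. \<forall>r::nat. real r \<le> ln (real n) / (15 * ln (ln (real n))) \<longrightarrow>
           (\<forall>w\<in>gsphere G v r. card (edges_between G {w} (gball G v r)) \<le> 5)))"

text \<open>
  Pseudo-randomness is an asymptotic notion: \<open>\<alpha>\<close> and \<open>G\<close> are sequences indexed by the number of
  vertices, and the conditions are required for all sufficiently large \<open>n\<close> (for a large constant
  \<open>\<alpha>\<close> and small \<open>n\<close> no graph has the required degrees).  In the codegree condition, ``for every
  large enough constant \<open>K\<close>'' refers to a threshold \<open>K0\<close> that does not depend on \<open>n\<close>; with a
  threshold depending on \<open>n\<close> the condition would be void, as no codegree exceeds \<open>n\<close>.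
\<close>

definition pseudo_random :: "(nat \<Rightarrow> real) \<Rightarrow> (nat \<Rightarrow> graph) \<Rightarrow> bool" where
  "pseudo_random \<alpha> G \<longleftrightarrow>
     (\<forall>\<^sub>F n in sequentially.
        graph_connected n (G n) \<and> degree_cond (\<alpha> n) n (G n) \<and> boundary_cond (\<alpha> n) n (G n) \<and>
        medium_set_cond (\<alpha> n) n (G n) \<and> local_sparsity_cond (\<alpha> n) n (G n)) \<and>
     (\<exists>K0>0. \<forall>K\<ge>K0. \<forall>\<^sub>F n in sequentially. codegree_cond K (\<alpha> n) n (G n))"

text \<open>
  The walk of length \<open>L\<close> is the random list \<open>[X\<^sub>0, \<dots>, X\<^sub>L]\<close>.  At an isolated vertex the step is
  unspecified.
\<close>

definition lazy_step :: "graph \<Rightarrow> nat \<Rightarrow> nat pmf" where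
  "lazy_step G v =
     bind_pmf (bernoulli_pmf (1/2))
       (\<lambda>stay. if stay then return_pmf v else pmf_of_set (neighbours G v))"

primrec lazy_walk :: "graph \<Rightarrow> nat \<Rightarrow> nat \<Rightarrow> nat list pmf" where
  "lazy_walk G 0 v = return_pmf [v]"
| "lazy_walk G (Suc L) v =
     bind_pmf (lazy_step G v) (\<lambda>u. map_pmf (\<lambda>xs. v # xs) (lazy_walk G L u))"

text \<open>
  The multigraph of traversed edges, as a multiset of edges; lazy steps traverse no edge.
\<close>

definition walk_trace :: "nat list \<Rightarrow> nat set multiset" where
  "walk_trace xs =
     image_mset (\<lambda>(u, v). {u, v}) (filter_mset (\<lambda>(u, v). u \<noteq> v) (mset (zip xs (tl xs))))"

definition mg_ext_nbhd :: "nat set multiset \<Rightarrow> nat set \<Rightarrow> nat set" where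
  "mg_ext_nbhd \<Gamma> A = ext_nbhd (set_mset \<Gamma>) A"

definition walk_length :: "real \<Rightarrow> nat \<Rightarrow> nat" where
  "walk_length \<epsilon> n = nat \<lfloor>(2 + \<epsilon>) * real n * ln (real n)\<rfloor>"

end

theory Submission
  imports Defs "HOL-Real_Asymp.Real_Asymp"
begin

text \<open>
  The boundary condition gives a Cheeger-type spectral gap, so the walk mixes in \<open>T = O(ln n)\<close> steps.
  Let \<open>g\<close> be the Green function of a vertex \<open>v\<close> truncated at \<open>T\<close>; each step enters \<open>v\<close> from outside
  with probability \<open>O(1 / (\<alpha> ln n))\<close>, so \<open>g \<le> 2 + O(1 / \<alpha>) = 2 + O(\<epsilon>\<^sup>2)\<close>.  The function \<open>1 - \<eta> g\<close> with \<open>\<eta>\<close> slightly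
  below \<open>1/2\<close> is then superharmonic, with decay \<open>1 - (1 - O(\<epsilon>)) / (2 n)\<close> per step, for the walk that
  is weighted by a small \<open>s > 0\<close> at each exit from \<open>v\<close>.  As the walk has \<open>(2 + \<epsilon>) n ln n\<close> steps, \<open>v\<close> is
  left fewer than \<open>\<delta> ln n\<close> times only with probability \<open>n\<^sup>-\<^sup>1\<^sup>-\<^sup>c\<close>, and a union bound covers all \<open>v\<close>.

  For a fixed set \<open>A\<close>, consider the first \<open>\<delta> ln n\<close> exits from each of its vertices.  If \<open>A\<close> has few
  neighbours in the trace, most of these exits lead into \<open>A\<close>, to vertices of large codegree, or to
  vertices hit before.  By the codegree condition (and a maximum cut of \<open>A\<close>, for the edges inside \<open>A\<close>)
  this has a small rate \<open>q\<close> per exit, and an exponential supermartingale bounds the probability by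
  \<open>n\<close> to the power \<open>-2 |A|\<close>, which is summable over all \<open>A\<close>.
\<close>

text \<open>Keeps the simplifier from turning \<open>{1..n}\<close> into \<open>{Suc 0..n}\<close>.\<close>

declare One_nat_def [simp del]

subsection \<open>Spectral gap and mixing\<close>

lemma neighbours_sym: "u \<in> neighbours G v \<longleftrightarrow> v \<in> neighbours G u"
  by (simp add: neighbours_def adj_def insert_commute)

section \<open>The lazy walk without isolated vertices and its Dirichlet form\<close>

locale walk_graph =
  fixes n :: nat and G :: graph
  assumes graph: "graph_on n G"
    and deg_pos: "\<And>v. v \<in> {1..n} \<Longrightarrow> 0 < deg G v"
begin

abbreviation "V \<equiv> {1..n}"
abbreviation "N \<equiv> neighbours G"
abbreviation "d v \<equiv> real (deg G v)"

lemma N_subset: "N v \<subseteq> V - {v}"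
proof
  fix u assume "u \<in> N v"
  then have "{v, u} \<in> G" by (simp add: neighbours_def adj_def)
  then have "{v, u} \<subseteq> V" "card {v, u} = 2" using graph by (auto simp: graph_on_def)
  then show "u \<in> V - {v}" by (cases "u = v") auto
qed

lemma finite_N [simp]: "finite (N v)"
  using N_subset[of v] finite_subset by blast

lemma N_not_empty: "v \<in> V \<Longrightarrow> N v \<noteq> {}"
  using deg_pos[of v] by (auto simp: deg_def)

lemma d_pos: "v \<in> V \<Longrightarrow> 0 < d v"
  using deg_pos by simp

lemma sum_N_eq: "(\<Sum>y\<in>N x. f y) = (\<Sum>y\<in>V. if y \<in> N x then f y else (0::real))"
proof -
  have "(\<Sum>y\<in>V. if y \<in> N x then f y else 0) = (\<Sum>y\<in>V \<inter> N x. f y)"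
    by (simp add: sum.inter_restrict)
  moreover have "V \<inter> N x = N x" using N_subset by blast
  ultimately show ?thesis by simp
qed

lemma sum_edges_swap:
  "(\<Sum>x\<in>V. \<Sum>y\<in>N x. f x y) = (\<Sum>x\<in>V. \<Sum>y\<in>N x. f y x :: real)"
proof -
  have "(\<Sum>x\<in>V. \<Sum>y\<in>N x. f x y) = (\<Sum>x\<in>V. \<Sum>y\<in>V. if y \<in> N x then f x y else 0)"
    by (simp add: sum_N_eq)
  also have "\<dots> = (\<Sum>y\<in>V. \<Sum>x\<in>V. if y \<in> N x then f x y else 0)"
    by (rule sum.swap)
  also have "\<dots> = (\<Sum>y\<in>V. \<Sum>x\<in>N y. f x y)"
    by (simp add: sum_N_eq neighbours_sym)
  finally show ?thesis .
qed

lemma sum_edges_fst: "(\<Sum>x\<in>V. \<Sum>y\<in>N x. f x) = (\<Sum>x\<in>V. d x * f x)"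
  by (simp add: deg_def)

lemma sum_edges_snd: "(\<Sum>x\<in>V. \<Sum>y\<in>N x. f y) = (\<Sum>x\<in>V. d x * f x)"
  using sum_edges_swap[of "\<lambda>x y. f y"] sum_edges_fst[of f] by simp

text \<open>The Markov operator of the lazy walk acting on functions. Below, \<open>energy\<close>
  runs over oriented edges and so counts every edge twice; \<open>sqnorm\<close> is taken in the
  degree measure, the unnormalised stationary one.\<close>

definition lazy_op :: "(nat \<Rightarrow> real) \<Rightarrow> nat \<Rightarrow> real" where
  "lazy_op f x = f x / 2 + (\<Sum>y\<in>N x. f y) / (2 * d x)"

definition energy :: "(nat \<Rightarrow> real) \<Rightarrow> real" where
  "energy f = (\<Sum>x\<in>V. \<Sum>y\<in>N x. (f x - f y)\<^sup>2)"

definition sqnorm :: "(nat \<Rightarrow> real) \<Rightarrow> real" where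
  "sqnorm f = (\<Sum>x\<in>V. d x * (f x)\<^sup>2)"

text \<open>Since \<open>lazy_op f x\<close> averages \<open>(f x + f y) / 2\<close> over the
  neighbours, Cauchy-Schwarz and the parallelogram identity give the bound. Laziness makes a single
  application contract, with no concern about negative eigenvalues.\<close>

lemma sqnorm_lazy_op_le: "sqnorm (lazy_op f) \<le> sqnorm f - energy f / 4"
proof -
  have "d x * (lazy_op f x)\<^sup>2 \<le> (\<Sum>y\<in>N x. ((f x + f y) / 2)\<^sup>2)" if "x \<in> V" for x
  proof -
    have dx: "d x > 0" using d_pos[OF that] .
    have eq: "d x * lazy_op f x = (\<Sum>y\<in>N x. (f x + f y) / 2)"
      using dx by (simp add: lazy_op_def sum_divide_distrib[symmetric] sum.distrib deg_def field_simps)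
    have "(d x * lazy_op f x)\<^sup>2 \<le> (\<Sum>y\<in>N x. ((f x + f y) / 2)\<^sup>2) * d x"
      unfolding eq unfolding deg_def by (rule sum_squared_le_sum_of_squares)
    then have "d x * (d x * (lazy_op f x)\<^sup>2) \<le> d x * (\<Sum>y\<in>N x. ((f x + f y) / 2)\<^sup>2)"
      by (simp add: power2_eq_square mult_ac)
    then show ?thesis using dx mult_le_cancel_left_pos by blast
  qed
  then have "sqnorm (lazy_op f) \<le> (\<Sum>x\<in>V. \<Sum>y\<in>N x. ((f x + f y) / 2)\<^sup>2)"
    unfolding sqnorm_def by (rule sum_mono)
  also have "\<dots> = (\<Sum>x\<in>V. \<Sum>y\<in>N x. (f x)\<^sup>2 / 2 + (f y)\<^sup>2 / 2 - (f x - f y)\<^sup>2 / 4)"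
    by (intro sum.cong refl) (simp add: power2_eq_square field_simps)
  also have "\<dots> = (\<Sum>x\<in>V. \<Sum>y\<in>N x. (f x)\<^sup>2 / 2) + (\<Sum>x\<in>V. \<Sum>y\<in>N x. (f y)\<^sup>2 / 2) - energy f / 4"
    by (simp add: sum.distrib sum_subtractf energy_def sum_divide_distrib)
  also have "\<dots> = sqnorm f - energy f / 4"
    unfolding sum_edges_fst[of "\<lambda>x. (f x)\<^sup>2 / 2"] sum_edges_snd[of "\<lambda>x. (f x)\<^sup>2 / 2"]
    by (simp add: sqnorm_def sum_divide_distrib[symmetric])
  finally show ?thesis .
qed

section \<open>Edge cuts, the coarea inequality and the Cheeger bound\<close>

definition links :: "nat set \<Rightarrow> nat set \<Rightarrow> real" where
  "links A B = (\<Sum>x\<in>A. real (card (N x \<inter> B)))"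

text \<open>Induction on the size of the support, subtracting the least positive value of \<open>h\<close> from it.\<close>

lemma coarea:
  fixes h :: "nat \<Rightarrow> real" and \<phi> :: real
  assumes "\<And>x. x \<in> V \<Longrightarrow> 0 \<le> h x"
    and "\<And>S. S \<subseteq> {x\<in>V. h x > 0} \<Longrightarrow> S \<noteq> {} \<Longrightarrow> \<phi> * card S \<le> links S (V - S)"
  shows "2 * \<phi> * (\<Sum>x\<in>V. h x) \<le> (\<Sum>x\<in>V. \<Sum>y\<in>N x. \<bar>h x - h y\<bar>)"
  using assms
proof (induction "card {x\<in>V. h x > 0}" arbitrary: h rule: less_induct)
  case less
  define S where "S = {x\<in>V. h x > 0}"
  have finS: "finite S" by (simp add: S_def)
  have zero: "h x = 0" if "x \<in> V" "x \<notin> S" for x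
    using less.prems(1)[of x] that by (auto simp: S_def)
  show ?case
  proof (cases "S = {}")
    case True
    then have "\<And>x. x \<in> V \<Longrightarrow> h x = 0" using zero by blast
    then have "(\<Sum>x\<in>V. h x) = 0" by simp
    then show ?thesis by (simp add: sum_nonneg)
  next
    case False
    define \<mu> where "\<mu> = Min (h ` S)"
    have \<mu>le: "\<mu> \<le> h x" if "x \<in> S" for x using that finS by (simp add: \<mu>_def)
    have "\<mu> \<in> h ` S" unfolding \<mu>_def using finS False by (intro Min_in) auto
    then obtain z where z: "z \<in> S" "h z = \<mu>" by auto
    then have \<mu>pos: "\<mu> > 0" by (auto simp: S_def)
    define h' where "h' x = (if x \<in> S then h x - \<mu> else h x)" for x
    have h'nn: "0 \<le> h' x" if "x \<in> V" for x using \<mu>le less.prems(1)[OF that] by (auto simp: h'_def)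
    have supp: "{x\<in>V. h' x > 0} \<subseteq> S - {z}"
      using z zero by (auto simp: h'_def S_def split: if_splits)
    have cardlt: "card {x\<in>V. h' x > 0} < card S"
      using supp finS z(1) by (meson card_Diff1_less card_mono finite_Diff le_less_trans)
    have IH: "2 * \<phi> * (\<Sum>x\<in>V. h' x) \<le> (\<Sum>x\<in>V. \<Sum>y\<in>N x. \<bar>h' x - h' y\<bar>)"
    proof (rule less.hyps)
      show "card {x\<in>V. h' x > 0} < card {x\<in>V. h x > 0}" using cardlt by (simp add: S_def)
      show "\<And>x. x \<in> V \<Longrightarrow> 0 \<le> h' x" by (rule h'nn)
      fix R assume "R \<subseteq> {x\<in>V. h' x > 0}" "R \<noteq> {}"
      then show "\<phi> * card R \<le> links R (V - R)"
        using supp less.prems(2)[of R] by (auto simp: S_def)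
    qed
    \<comment> \<open>As \<open>h\<close> vanishes off \<open>S\<close>, only cut edges change, and
      each orientation of a cut edge loses exactly \<open>\<mu>\<close>.\<close>
    have eq: "\<bar>h x - h y\<bar> = \<bar>h' x - h' y\<bar> + \<mu> * (if x \<in> S \<and> y \<notin> S then 1 else 0)
        + \<mu> * (if y \<in> S \<and> x \<notin> S then 1 else 0)" if "x \<in> V" "y \<in> N x" for x y
    proof -
      have "y \<in> V" using that N_subset by blast
      then show ?thesis using that zero[of x] zero[of y] \<mu>le[of x] \<mu>le[of y] \<mu>pos
        by (auto simp: h'_def)
    qed
    have SV: "S \<subseteq> V" by (auto simp: S_def)
    have cut: "(\<Sum>x\<in>V. \<Sum>y\<in>N x. if x \<in> S \<and> y \<notin> S then 1 else 0) = links S (V - S)"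
    proof -
      have "(\<Sum>y\<in>N x. if x \<in> S \<and> y \<notin> S then 1 else 0)
          = (if x \<in> S then real (card (N x \<inter> (V - S))) else 0)" for x
      proof -
        have "N x \<inter> (V - S) = {y \<in> N x. y \<notin> S}" using N_subset by blast
        then show ?thesis by (auto simp: sum.If_cases Int_def conj_commute)
      qed
      then have "(\<Sum>x\<in>V. \<Sum>y\<in>N x. if x \<in> S \<and> y \<notin> S then 1 else 0)
         = (\<Sum>x\<in>V. if x \<in> S then real (card (N x \<inter> (V - S))) else 0)" by (rule sum.cong[OF refl])
      also have "\<dots> = (\<Sum>x\<in>V \<inter> S. real (card (N x \<inter> (V - S))))"
        by (rule sum.inter_restrict[symmetric]) simp
      also have "V \<inter> S = S" using SV by blast
      finally show ?thesis by (simp add: links_def)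
    qed
    have "(\<Sum>x\<in>V. \<Sum>y\<in>N x. \<bar>h x - h y\<bar>) = (\<Sum>x\<in>V. \<Sum>y\<in>N x. \<bar>h' x - h' y\<bar>
        + \<mu> * (if x \<in> S \<and> y \<notin> S then 1 else 0) + \<mu> * (if y \<in> S \<and> x \<notin> S then 1 else 0))"
      by (intro sum.cong refl eq)
    also have "\<dots> = (\<Sum>x\<in>V. \<Sum>y\<in>N x. \<bar>h' x - h' y\<bar>)
        + \<mu> * (\<Sum>x\<in>V. \<Sum>y\<in>N x. if x \<in> S \<and> y \<notin> S then 1 else 0)
        + \<mu> * (\<Sum>x\<in>V. \<Sum>y\<in>N x. if y \<in> S \<and> x \<notin> S then 1 else 0)"
      by (simp add: sum.distrib sum_distrib_left)
    also have "(\<Sum>x\<in>V. \<Sum>y\<in>N x. if y \<in> S \<and> x \<notin> S then 1 else 0) = links S (V - S)"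
      using cut sum_edges_swap[of "\<lambda>x y. if x \<in> S \<and> y \<notin> S then 1 else 0"] by simp
    finally have A: "(\<Sum>x\<in>V. \<Sum>y\<in>N x. \<bar>h x - h y\<bar>)
        = (\<Sum>x\<in>V. \<Sum>y\<in>N x. \<bar>h' x - h' y\<bar>) + 2 * \<mu> * links S (V - S)"
      by (simp add: cut)
    have "(\<Sum>x\<in>V. h x) = (\<Sum>x\<in>V. h' x + (if x \<in> S then \<mu> else 0))"
      by (intro sum.cong refl) (simp add: h'_def)
    also have "\<dots> = (\<Sum>x\<in>V. h' x) + (\<Sum>x\<in>V \<inter> S. \<mu>)"
      by (simp only: sum.distrib sum.inter_restrict finite_atLeastAtMost)
    also have "V \<inter> S = S" using SV by blast
    finally have B: "(\<Sum>x\<in>V. h x) = (\<Sum>x\<in>V. h' x) + card S * \<mu>" by simp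
    have "\<phi> * card S \<le> links S (V - S)"
      using less.prems(2)[of S] False by (simp add: S_def)
    then have "\<mu> * (\<phi> * card S) \<le> \<mu> * links S (V - S)" using \<mu>pos by simp
    then show ?thesis using IH unfolding A B by (simp add: algebra_simps)
  qed
qed

end

text \<open>Take \<open>m\<close> least among the values of \<open>f\<close> with at most half of
  the points strictly above. The largest value below \<open>m\<close> then has more than half of the
  points above it, and these are disjoint from the points below \<open>m\<close>.\<close>

lemma exists_median:
  fixes f :: "'a \<Rightarrow> real"
  assumes "finite V"
  obtains m where "2 * card {x\<in>V. f x > m} \<le> card V" "2 * card {x\<in>V. f x < m} \<le> card V"
proof (cases "V = {}")
  case True
  then show ?thesis using that by simp
next
  case False
  define R where "R = {t \<in> f ` V. 2 * card {x\<in>V. f x > t} \<le> card V}"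
  have fin: "finite R" using assms by (simp add: R_def)
  have "Max (f ` V) \<in> f ` V" using assms False by (intro Max_in) auto
  moreover have "{x\<in>V. f x > Max (f ` V)} = {}" using assms by (auto simp: not_less)
  then have "2 * card {x\<in>V. f x > Max (f ` V)} \<le> card V" by (simp only: card.empty)
  ultimately have "Max (f ` V) \<in> R" by (simp add: R_def)
  then have ne: "R \<noteq> {}" by blast
  define m where "m = Min R"
  have "m \<in> R" using fin ne by (simp add: m_def)
  then have 1: "2 * card {x\<in>V. f x > m} \<le> card V" by (simp add: R_def)
  have 2: "2 * card {x\<in>V. f x < m} \<le> card V"
  proof (cases "{x\<in>V. f x < m} = {}")
    case True
    then show ?thesis by (simp only: card.empty)
  next
    case ne': False
    define t where "t = Max (f ` {x\<in>V. f x < m})"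
    have "t \<in> f ` {x\<in>V. f x < m}" unfolding t_def using assms ne' by (intro Max_in) auto
    then have t: "t \<in> f ` V" "t < m" by auto
    have tmax: "f x \<le> t" if "x \<in> V" "f x < m" for x
      unfolding t_def using that assms by (intro Max_ge) auto
    have "t \<notin> R" using t(2) Min_le[OF fin, of t] unfolding m_def by (meson not_le)
    then have big: "2 * card {x\<in>V. f x > t} > card V" using t by (simp add: R_def)
    have "{x\<in>V. f x > t} \<inter> {x\<in>V. f x < m} = {}" using tmax by force
    then have "card {x\<in>V. f x > t} + card {x\<in>V. f x < m} = card ({x\<in>V. f x > t} \<union> {x\<in>V. f x < m})"
      using assms by (simp add: card_Un_disjoint)
    also have "\<dots> \<le> card V" using assms by (intro card_mono) auto
    finally show ?thesis using big by simp
  qed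
  show ?thesis using that 1 2 by blast
qed

context walk_graph begin

text \<open>Cheeger's inequality: the coarea bound is applied to the square of \<open>g\<close>, and
  the difference of squares factors and splits by a weighted AM-GM inequality into an energy term
  and a norm term.\<close>

lemma energy_ge_small_support:
  fixes g :: "nat \<Rightarrow> real" and \<phi> \<Delta> :: real
  assumes nonneg: "\<And>x. x \<in> V \<Longrightarrow> 0 \<le> g x"
    and cut: "\<And>S. S \<subseteq> {x\<in>V. g x > 0} \<Longrightarrow> S \<noteq> {} \<Longrightarrow> \<phi> * card S \<le> links S (V - S)"
    and deg: "\<And>x. x \<in> V \<Longrightarrow> d x \<le> \<Delta>" and pos: "0 < \<phi>" "0 < \<Delta>"
  shows "(\<phi> / \<Delta>)\<^sup>2 * sqnorm g \<le> energy g"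
proof -
  \<comment> \<open>With this weight the coarea lower bound is at least
    \<open>4 * l * sqnorm g\<close>, twice the norm term of the AM-GM upper bound, so half of it is
    left for the energy.\<close>
  define l where "l = \<phi> / (2 * \<Delta>)"
  have l: "l > 0" using pos by (simp add: l_def)
  have "(\<Sum>x\<in>V. \<Sum>y\<in>N x. \<bar>(g x)\<^sup>2 - (g y)\<^sup>2\<bar>)
      \<le> (\<Sum>x\<in>V. \<Sum>y\<in>N x. (g x - g y)\<^sup>2 / (2 * l) + l * ((g x)\<^sup>2 + (g y)\<^sup>2))"
  proof (intro sum_mono)
    fix x y
    have "0 \<le> (\<bar>g x - g y\<bar> - l * \<bar>g x + g y\<bar>)\<^sup>2" by simp
    then have "2 * l * (\<bar>g x - g y\<bar> * \<bar>g x + g y\<bar>) \<le> (g x - g y)\<^sup>2 + l\<^sup>2 * (g x + g y)\<^sup>2"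
      by (simp add: power2_diff power_mult_distrib mult_ac)
    also have "\<dots> \<le> (g x - g y)\<^sup>2 + l\<^sup>2 * (2 * ((g x)\<^sup>2 + (g y)\<^sup>2))"
      using sum_squares_bound[of "g x" "g y"] by (intro add_left_mono mult_left_mono) (simp_all add: power2_sum)
    finally have "2 * l * \<bar>(g x)\<^sup>2 - (g y)\<^sup>2\<bar> \<le> (g x - g y)\<^sup>2 + l\<^sup>2 * (2 * ((g x)\<^sup>2 + (g y)\<^sup>2))"
      by (simp add: abs_mult[symmetric] square_diff_square_factored power2_eq_square mult_ac)
    then show "\<bar>(g x)\<^sup>2 - (g y)\<^sup>2\<bar> \<le> (g x - g y)\<^sup>2 / (2 * l) + l * ((g x)\<^sup>2 + (g y)\<^sup>2)"
      using l by (simp add: field_simps power2_eq_square)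
  qed
  also have "\<dots> = energy g / (2 * l) + l * ((\<Sum>x\<in>V. \<Sum>y\<in>N x. (g x)\<^sup>2) + (\<Sum>x\<in>V. \<Sum>y\<in>N x. (g y)\<^sup>2))"
    by (simp only: sum.distrib energy_def sum_divide_distrib sum_distrib_left distrib_left)
  also have "\<dots> = energy g / (2 * l) + 2 * l * sqnorm g"
    unfolding sum_edges_fst[of "\<lambda>x. (g x)\<^sup>2"] sum_edges_snd[of "\<lambda>x. (g x)\<^sup>2"] by (simp add: sqnorm_def)
  finally have upper: "(\<Sum>x\<in>V. \<Sum>y\<in>N x. \<bar>(g x)\<^sup>2 - (g y)\<^sup>2\<bar>) \<le> energy g / (2 * l) + 2 * l * sqnorm g" .
  have lower: "2 * \<phi> * (\<Sum>x\<in>V. (g x)\<^sup>2) \<le> (\<Sum>x\<in>V. \<Sum>y\<in>N x. \<bar>(g x)\<^sup>2 - (g y)\<^sup>2\<bar>)"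
  proof (rule coarea)
    fix S assume "S \<subseteq> {x\<in>V. 0 < (g x)\<^sup>2}" "S \<noteq> {}"
    moreover have "{x\<in>V. 0 < (g x)\<^sup>2} = {x\<in>V. g x > 0}" using nonneg by force
    ultimately show "\<phi> * card S \<le> links S (V - S)" using cut by blast
  qed simp
  have "sqnorm g \<le> (\<Sum>x\<in>V. \<Delta> * (g x)\<^sup>2)"
    unfolding sqnorm_def by (intro sum_mono mult_right_mono deg) auto
  then have "4 * l * sqnorm g \<le> 4 * l * (\<Delta> * (\<Sum>x\<in>V. (g x)\<^sup>2))"
    using l by (intro mult_left_mono) (auto simp: sum_distrib_left)
  also have "\<dots> = 2 * \<phi> * (\<Sum>x\<in>V. (g x)\<^sup>2)" using pos by (simp add: l_def)
  finally have "2 * l * sqnorm g \<le> energy g / (2 * l)" using lower upper by linarith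
  then have "4 * l\<^sup>2 * sqnorm g \<le> energy g" using l by (simp add: field_simps power2_eq_square)
  moreover have "4 * l\<^sup>2 = (\<phi> / \<Delta>)\<^sup>2" by (simp add: l_def power_divide power_mult_distrib)
  ultimately show ?thesis by simp
qed

text \<open>Both parts of \<open>f - m\<close>, for a median \<open>m\<close>, are supported on at
  most half of the vertices, where the cut bound applies. Their energies add up to at most
  \<open>energy f\<close>, and as \<open>f\<close> has mean zero, the shift by \<open>m\<close>
  cannot decrease the norm.\<close>

lemma poincare:
  fixes f :: "nat \<Rightarrow> real" and \<phi> \<Delta> :: real
  assumes mean: "(\<Sum>x\<in>V. d x * f x) = 0"
    and cut: "\<And>S. S \<subseteq> V \<Longrightarrow> S \<noteq> {} \<Longrightarrow> 2 * card S \<le> n \<Longrightarrow> \<phi> * card S \<le> links S (V - S)"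
    and deg: "\<And>x. x \<in> V \<Longrightarrow> d x \<le> \<Delta>" and pos: "0 < \<phi>" "0 < \<Delta>"
  shows "(\<phi> / \<Delta>)\<^sup>2 * sqnorm f \<le> energy f"
proof -
  obtain m where m: "2 * card {x\<in>V. f x > m} \<le> card V" "2 * card {x\<in>V. f x < m} \<le> card V"
    by (rule exists_median[of V f]) auto
  define g1 where "g1 x = max (f x - m) 0" for x
  define g2 where "g2 x = max (m - f x) 0" for x
  have small: "\<phi> * card S \<le> links S (V - S)" if "S \<subseteq> R" "R \<subseteq> V" "S \<noteq> {}" "2 * card R \<le> card V" for S R
  proof (rule cut)
    have "card S \<le> card R" using that finite_subset by (intro card_mono) auto
    then show "2 * card S \<le> n" using that(4) by simp
  qed (use that in auto)
  have "(\<phi> / \<Delta>)\<^sup>2 * sqnorm g1 \<le> energy g1"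
  proof (rule energy_ge_small_support)
    fix S assume S: "S \<subseteq> {x\<in>V. g1 x > 0}" "S \<noteq> {}"
    have "{x\<in>V. g1 x > 0} = {x\<in>V. f x > m}" by (auto simp: g1_def)
    then show "\<phi> * card S \<le> links S (V - S)" using small[of S "{x\<in>V. f x > m}"] S m(1) by blast
  qed (use deg pos in \<open>auto simp: g1_def\<close>)
  moreover have "(\<phi> / \<Delta>)\<^sup>2 * sqnorm g2 \<le> energy g2"
  proof (rule energy_ge_small_support)
    fix S assume S: "S \<subseteq> {x\<in>V. g2 x > 0}" "S \<noteq> {}"
    have "{x\<in>V. g2 x > 0} = {x\<in>V. f x < m}" by (auto simp: g2_def)
    then show "\<phi> * card S \<le> links S (V - S)" using small[of S "{x\<in>V. f x < m}"] S m(2) by blast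
  qed (use deg pos in \<open>auto simp: g2_def\<close>)
  moreover have "energy g1 + energy g2 \<le> energy f"
    unfolding energy_def sum.distrib[symmetric]
  proof (intro sum_mono)
    fix x y
    have "max a 0 = a \<and> max (-a) 0 = 0 \<or> max a 0 = 0 \<and> max (-a) 0 = -a" for a :: real by linarith
    from this[of "f x - m"] this[of "f y - m"]
    consider "g1 x = f x - m" "g2 x = 0" "g1 y = f y - m" "g2 y = 0"
      | "g1 x = f x - m" "g2 x = 0" "g1 y = 0" "g2 y = m - f y" "f x \<ge> m" "m \<ge> f y"
      | "g1 x = 0" "g2 x = m - f x" "g1 y = f y - m" "g2 y = 0" "f y \<ge> m" "m \<ge> f x"
      | "g1 x = 0" "g2 x = m - f x" "g1 y = 0" "g2 y = m - f y"
      unfolding g1_def g2_def by (smt (verit))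
    then show "(g1 x - g1 y)\<^sup>2 + (g2 x - g2 y)\<^sup>2 \<le> (f x - f y)\<^sup>2"
    proof cases
      case 2
      have "(f x - f y)\<^sup>2 = (f x - m)\<^sup>2 + (m - f y)\<^sup>2 + 2 * ((f x - m) * (m - f y))"
        by (simp add: power2_eq_square algebra_simps)
      moreover have "0 \<le> (f x - m) * (m - f y)" using 2 by simp
      ultimately show ?thesis using 2 by (simp add: power2_commute[of "f y"])
    next
      case 3
      have "(f x - f y)\<^sup>2 = (m - f x)\<^sup>2 + (f y - m)\<^sup>2 + 2 * ((f y - m) * (m - f x))"
        by (simp add: power2_eq_square algebra_simps)
      moreover have "0 \<le> (f y - m) * (m - f x)" using 3 by simp
      ultimately show ?thesis using 3 by (simp add: power2_commute[of "f y" m])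
    qed (simp_all add: power2_commute)
  qed
  moreover have "sqnorm f \<le> sqnorm g1 + sqnorm g2"
  proof -
    have "sqnorm g1 + sqnorm g2 = (\<Sum>x\<in>V. d x * (f x - m)\<^sup>2)"
      unfolding sqnorm_def sum.distrib[symmetric]
      by (intro sum.cong refl) (auto simp: g1_def g2_def max_def power2_eq_square algebra_simps)
    also have "\<dots> = (\<Sum>x\<in>V. d x * (f x)\<^sup>2 - 2 * m * (d x * f x) + d x * m\<^sup>2)"
      by (intro sum.cong refl) (simp add: power2_eq_square algebra_simps)
    also have "\<dots> = sqnorm f - 2 * m * (\<Sum>x\<in>V. d x * f x) + (\<Sum>x\<in>V. d x * m\<^sup>2)"
      by (simp add: sum.distrib sum_subtractf sum_distrib_left sqnorm_def)
    also have "\<dots> \<ge> sqnorm f" unfolding mean by (simp add: sum_nonneg)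
    finally show ?thesis .
  qed
  ultimately show ?thesis
    by (smt (verit) distrib_left mult_left_mono zero_le_power2)
qed

section \<open>Decay of mean-zero functions and mixing\<close>

lemma sum_lazy_op: "(\<Sum>x\<in>V. d x * lazy_op f x) = (\<Sum>x\<in>V. d x * f x)"
proof -
  have "(\<Sum>x\<in>V. d x * lazy_op f x) = (\<Sum>x\<in>V. d x * f x / 2 + (\<Sum>y\<in>N x. f y) / 2)"
  proof (intro sum.cong refl)
    fix x assume "x \<in> V"
    then show "d x * lazy_op f x = d x * f x / 2 + (\<Sum>y\<in>N x. f y) / 2"
      using d_pos[of x] by (simp add: lazy_op_def field_simps)
  qed
  also have "\<dots> = (\<Sum>x\<in>V. d x * f x)"
    using sum_edges_snd[of f] by (simp only: sum.distrib sum_divide_distrib[symmetric])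
  finally show ?thesis .
qed

text \<open>The operator preserves the degree-weighted mean, so the Poincare bound applies at every
  step. The hypothesis \<open>\<phi> \<le> 2 * \<Delta>\<close> keeps the contraction factor
  nonnegative.\<close>

lemma sqnorm_lazy_op_iterate_le:
  fixes \<phi> \<Delta> :: real
  assumes mean: "(\<Sum>x\<in>V. d x * f x) = 0"
    and cut: "\<And>S. S \<subseteq> V \<Longrightarrow> S \<noteq> {} \<Longrightarrow> 2 * card S \<le> n \<Longrightarrow> \<phi> * card S \<le> links S (V - S)"
    and deg: "\<And>x. x \<in> V \<Longrightarrow> d x \<le> \<Delta>" and pos: "0 < \<phi>" "0 < \<Delta>" and le: "\<phi> \<le> 2 * \<Delta>"
  shows "sqnorm ((lazy_op ^^ t) f) \<le> (1 - (\<phi> / \<Delta>)\<^sup>2 / 4) ^ t * sqnorm f"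
proof (induction t)
  case (Suc t)
  let ?g = "(lazy_op ^^ t) f"
  have mean': "(\<Sum>x\<in>V. d x * ?g x) = 0"
    using mean by (induction t) (simp_all add: sum_lazy_op)
  have "\<phi> / \<Delta> \<le> 2" using le pos by (simp add: field_simps)
  then have "(\<phi> / \<Delta>)\<^sup>2 \<le> 2\<^sup>2" using pos by (intro power_mono) auto
  then have nn: "0 \<le> 1 - (\<phi> / \<Delta>)\<^sup>2 / 4" by simp
  have "sqnorm (lazy_op ?g) \<le> (1 - (\<phi> / \<Delta>)\<^sup>2 / 4) * sqnorm ?g"
    using sqnorm_lazy_op_le[of ?g] poincare[OF mean' cut deg pos] by (simp add: algebra_simps)
  also have "\<dots> \<le> (1 - (\<phi> / \<Delta>)\<^sup>2 / 4) * ((1 - (\<phi> / \<Delta>)\<^sup>2 / 4) ^ t * sqnorm f)"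
    by (rule mult_left_mono[OF Suc.IH nn])
  finally show ?case by (simp add: mult.assoc)
qed simp

lemma lazy_op_const: "x \<in> V \<Longrightarrow> lazy_op (\<lambda>_. c) x = c"
  using d_pos[of x] N_not_empty[of x] by (simp add: lazy_op_def deg_def)

lemma lazy_op_add: "lazy_op (\<lambda>x. f x + g x) x = lazy_op f x + lazy_op g x"
  by (simp add: lazy_op_def sum.distrib add_divide_distrib)

lemma lazy_op_cmult: "lazy_op (\<lambda>x. c * f x) x = c * lazy_op f x"
  by (simp add: lazy_op_def sum_distrib_left[symmetric] algebra_simps)

lemma lazy_op_sum: "lazy_op (\<lambda>x. \<Sum>i\<in>I. f i x) x = (\<Sum>i\<in>I. lazy_op (f i) x)"
  by (simp add: lazy_op_def sum.distrib sum_divide_distrib sum.swap[of _ I])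

lemma lazy_op_cong:
  assumes "x \<in> V" "\<And>y. y \<in> V \<Longrightarrow> f y = g y"
  shows "lazy_op f x = lazy_op g x"
proof -
  have "(\<Sum>y\<in>N x. f y) = (\<Sum>y\<in>N x. g y)"
    using assms(2) N_subset[of x] by (intro sum.cong refl) blast
  then show ?thesis using assms by (simp add: lazy_op_def)
qed

text \<open>The probability that the walk from \<open>x\<close> is at \<open>v\<close> at time
  \<open>t\<close>, not that of a first visit.\<close>

definition hit_prob :: "nat \<Rightarrow> nat \<Rightarrow> nat \<Rightarrow> real" where
  "hit_prob v t = (lazy_op ^^ t) (indicator {v})"

lemma hit_prob_0: "hit_prob v 0 x = (if x = v then 1 else 0)"
  by (simp add: hit_prob_def)

lemma hit_prob_Suc: "hit_prob v (Suc t) x = lazy_op (hit_prob v t) x"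
  by (simp add: hit_prob_def)

lemma hit_prob_nonneg: "0 \<le> hit_prob v t x"
  by (induction t arbitrary: x) (auto simp: hit_prob_0 hit_prob_Suc lazy_op_def intro!: sum_nonneg add_nonneg_nonneg divide_nonneg_nonneg)

text \<open>The centred indicator of \<open>v\<close> has mean zero and squared norm at most
  \<open>\<Delta>\<close>. The contraction bounds the whole norm at time \<open>t\<close>, hence its
  summand at \<open>x\<close>, whose weight is at least \<open>\<delta>\<close>.\<close>

lemma hit_prob_mixing:
  fixes \<phi> \<Delta> \<delta> :: real
  assumes v: "v \<in> V" and x: "x \<in> V"
    and cut: "\<And>S. S \<subseteq> V \<Longrightarrow> S \<noteq> {} \<Longrightarrow> 2 * card S \<le> n \<Longrightarrow> \<phi> * card S \<le> links S (V - S)"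
    and deg: "\<And>x. x \<in> V \<Longrightarrow> d x \<le> \<Delta>" "\<And>x. x \<in> V \<Longrightarrow> \<delta> \<le> d x"
    and pos: "0 < \<phi>" "0 < \<delta>" and le: "\<phi> \<le> 2 * \<Delta>"
  shows "(hit_prob v t x - d v / (\<Sum>y\<in>V. d y))\<^sup>2 \<le> (1 - (\<phi> / \<Delta>)\<^sup>2 / 4) ^ t * (\<Delta> / \<delta>)"
proof -
  define D where "D = (\<Sum>y\<in>V. d y)"
  define p where "p = d v / D"
  have Dpos: "D > 0" unfolding D_def using v d_pos by (intro sum_pos) auto
  have \<Delta>: "\<Delta> > 0" using deg(1)[OF v] d_pos[OF v] by linarith
  define f where "f x = indicator {v} x - p" for x
  have ind: "(\<Sum>x\<in>V. d x * indicator {v} x) = d v"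
  proof -
    have "(\<Sum>x\<in>V. d x * indicator {v} x) = (\<Sum>x\<in>V. if x = v then d x else 0)"
      by (intro sum.cong refl) (auto simp: indicator_def)
    then show ?thesis using v by simp
  qed
  have mean: "(\<Sum>x\<in>V. d x * f x) = 0"
  proof -
    have "(\<Sum>x\<in>V. d x * f x) = (\<Sum>x\<in>V. d x * indicator {v} x) - p * D"
      by (simp add: f_def right_diff_distrib sum_subtractf D_def sum_distrib_left mult.commute)
    then show ?thesis using ind Dpos by (simp add: p_def)
  qed
  have "sqnorm f = (\<Sum>x\<in>V. d x * indicator {v} x - 2 * p * (d x * indicator {v} x) + p\<^sup>2 * d x)"
    unfolding sqnorm_def by (intro sum.cong refl) (auto simp: f_def power2_eq_square algebra_simps indicator_def)
  also have "\<dots> = d v - 2 * p * d v + p\<^sup>2 * D"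
    by (simp add: sum.distrib sum_subtractf sum_distrib_left[symmetric] ind D_def)
  also have "\<dots> = d v - p * d v" using Dpos by (simp add: p_def power2_eq_square)
  also have "\<dots> \<le> \<Delta>" using deg(1)[OF v] Dpos by (smt (verit) p_def mult_nonneg_nonneg divide_nonneg_nonneg of_nat_0_le_iff)
  finally have f: "sqnorm f \<le> \<Delta>" .
  have it: "(lazy_op ^^ t) f x = hit_prob v t x - p" if "x \<in> V" for x
    using that
  proof (induction t arbitrary: x)
    case (Suc t)
    have "(lazy_op ^^ Suc t) f x = lazy_op (\<lambda>y. hit_prob v t y + (- p)) x"
      using lazy_op_cong[OF Suc.prems, of "(lazy_op ^^ t) f" "\<lambda>y. hit_prob v t y + (- p)"] Suc.IH by simp
    then show ?case using Suc.prems by (simp only: lazy_op_add lazy_op_const hit_prob_Suc)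
  qed (simp add: f_def hit_prob_def)
  have "\<delta> * (hit_prob v t x - p)\<^sup>2 \<le> d x * ((lazy_op ^^ t) f x)\<^sup>2"
    unfolding it[OF x] by (intro mult_right_mono deg x) auto
  also have "\<dots> \<le> sqnorm ((lazy_op ^^ t) f)"
    unfolding sqnorm_def using x by (intro member_le_sum) auto
  also have "\<dots> \<le> (1 - (\<phi> / \<Delta>)\<^sup>2 / 4) ^ t * sqnorm f"
    by (rule sqnorm_lazy_op_iterate_le[OF mean cut deg(1) pos(1) \<Delta> le])
  also have "\<dots> \<le> (1 - (\<phi> / \<Delta>)\<^sup>2 / 4) ^ t * \<Delta>"
  proof (intro mult_left_mono f zero_le_power)
    have "\<phi> / \<Delta> \<le> 2" using le \<Delta> by (simp add: field_simps)
    then have "(\<phi> / \<Delta>)\<^sup>2 \<le> 2\<^sup>2" using pos \<Delta> by (intro power_mono) auto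
    then show "0 \<le> 1 - (\<phi> / \<Delta>)\<^sup>2 / 4" by simp
  qed
  finally show ?thesis using pos by (simp add: field_simps p_def D_def)
qed

end

section \<open>Expectations under finitely supported distributions\<close>

lemma expectation_bind_finite:
  fixes h :: "'b \<Rightarrow> real"
  assumes "finite (set_pmf p)" "\<And>x. x \<in> set_pmf p \<Longrightarrow> finite (set_pmf (f x))"
  shows "measure_pmf.expectation (bind_pmf p f) h
    = measure_pmf.expectation p (\<lambda>x. measure_pmf.expectation (f x) h)"
proof -
  have "measure_pmf.expectation (bind_pmf p f) h
      = (\<Sum>a\<in>set_pmf p. pmf p a *\<^sub>R measure_pmf.expectation (f a) h)"
    using assms by (intro pmf_expectation_bind) auto
  also have "\<dots> = measure_pmf.expectation p (\<lambda>x. measure_pmf.expectation (f x) h)"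
    by (rule integral_measure_pmf[symmetric]) (use assms in auto)
  finally show ?thesis .
qed

lemma markov_finite_pmf:
  fixes f :: "'a \<Rightarrow> real"
  assumes fin: "finite (set_pmf p)" and nonneg: "\<And>x. 0 \<le> f x" and ge: "\<And>x. x \<in> S \<Longrightarrow> c \<le> f x"
  shows "c * measure_pmf.prob p S \<le> measure_pmf.expectation p f"
proof -
  have "c * measure_pmf.prob p S = measure_pmf.expectation p (\<lambda>x. c * indicator S x)"
    by simp
  also have "\<dots> \<le> measure_pmf.expectation p f"
    using nonneg ge by (intro integral_mono integrable_measure_pmf_finite fin) (auto simp: indicator_def)
  finally show ?thesis .
qed

subsection \<open>Supermartingales along the walk\<close>

text \<open>
  Histories of the walk are reversed lists, with the current position at the head.  Among the first
  \<open>m\<close> exits from each vertex of \<open>A\<close>, those that lead into \<open>B\<close> or to an earlier target are stale;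
  \<open>stale_rate\<close> adds up the conditional probabilities that these exits are stale.
\<close>

fun exits :: "nat \<Rightarrow> nat list \<Rightarrow> nat" where
  "exits v (y # x # zs) = exits v (x # zs) + (if x = v \<and> y \<noteq> v then 1 else 0)"
| "exits v _ = 0"

text \<open>A lazy stay at \<open>x \<in> A\<close> records \<open>x\<close> itself; this is
  harmless, as targets are only counted outside sets containing \<open>A\<close>.\<close>

fun targets :: "nat set \<Rightarrow> nat list \<Rightarrow> nat set" where
  "targets A (y # x # zs) = (if x \<in> A then insert y (targets A (x # zs)) else targets A (x # zs))"
| "targets A _ = {}"

fun stale_exits :: "nat set \<Rightarrow> nat set \<Rightarrow> nat \<Rightarrow> nat list \<Rightarrow> nat" where
  "stale_exits A B m (y # x # zs) = stale_exits A B m (x # zs)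
     + (if x \<in> A \<and> y \<noteq> x \<and> exits x (x # zs) < m \<and> y \<in> B \<union> targets A (x # zs) then 1 else 0)"
| "stale_exits A B m _ = 0"

fun stale_rate :: "graph \<Rightarrow> nat set \<Rightarrow> nat set \<Rightarrow> nat \<Rightarrow> nat list \<Rightarrow> real" where
  "stale_rate G A B m (y # x # zs) = stale_rate G A B m (x # zs)
     + (if x \<in> A \<and> y \<noteq> x \<and> exits x (x # zs) < m
        then card (neighbours G x \<inter> (B \<union> targets A (x # zs))) / deg G x else 0)"
| "stale_rate G A B m _ = 0"

lemma finite_targets [simp]: "finite (targets A zs)"
  by (induction A zs rule: targets.induct) auto

lemma targetsD: "y \<in> targets A zs \<Longrightarrow> \<exists>x\<in>A. \<exists>us ws. zs = us @ y # x # ws"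
proof (induction A zs rule: targets.induct)
  case (1 A y' x' zs)
  show ?case
  proof (cases "y = y' \<and> x' \<in> A")
    case True
    then show ?thesis by (intro bexI[of _ x'] exI[of _ "[]"] exI[of _ zs]) auto
  next
    case False
    then have "y \<in> targets A (x' # zs)" using "1.prems" by (auto split: if_splits)
    then obtain x us ws where "x \<in> A" "x' # zs = us @ y # x # ws"
      using 1 by (cases "x' \<in> A") blast+
    then show ?thesis by (intro bexI[of _ x] exI[of _ "y' # us"] exI[of _ ws]) auto
  qed
qed auto

text \<open>A target outside \<open>A\<close> was reached by a genuine move, so its edge is in the
  trace. One inclusion suffices to bound the neighbourhood from below.\<close>

lemma targets_subset_ext_nbhd: "targets A (rev xs) - A \<subseteq> mg_ext_nbhd (walk_trace xs) A"
proof
  fix y assume y: "y \<in> targets A (rev xs) - A"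
  then obtain x us ws where x: "x \<in> A" and eq: "rev xs = us @ y # x # ws" using targetsD by blast
  have xs: "xs = rev ws @ x # y # rev us" using arg_cong[OF eq, of rev] by simp
  have "(x, y) \<in> set (zip xs (tl xs))"
    unfolding xs in_set_zip
    by (rule exI[of _ "length ws"]) (simp add: nth_append nth_tl)
  moreover have "x \<noteq> y" using x y by auto
  ultimately have "{x, y} \<in> set_mset (walk_trace xs)"
    unfolding walk_trace_def by (force simp: image_iff)
  then show "y \<in> mg_ext_nbhd (walk_trace xs) A"
    using x y by (auto simp: mg_ext_nbhd_def ext_nbhd_def adj_def insert_commute intro!: bexI[of _ x])
qed

lemma finite_ext_nbhd_trace: "finite (mg_ext_nbhd (walk_trace xs) A)"
proof (rule finite_subset)
  show "mg_ext_nbhd (walk_trace xs) A \<subseteq> \<Union> (set_mset (walk_trace xs))"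
    by (auto simp: mg_ext_nbhd_def ext_nbhd_def adj_def)
  show "finite (\<Union> (set_mset (walk_trace xs)))"
    by (auto simp: walk_trace_def)
qed

text \<open>Each of the first \<open>m\<close> exits from a vertex of \<open>A\<close> is either
  stale or finds a new target outside \<open>B\<close>. Later exits may find targets too, hence an
  inequality.\<close>

lemma sum_min_exits_le:
  assumes "A \<subseteq> B" "finite A"
  shows "(\<Sum>v\<in>A. min m (exits v zs)) \<le> stale_exits A B m zs + card (targets A zs - B)"
  using assms
proof (induction A B m zs rule: stale_exits.induct)
  case (1 A B m y x zs)
  let ?W = "targets A (x # zs)"
  have IH: "(\<Sum>v\<in>A. min m (exits v (x # zs))) \<le> stale_exits A B m (x # zs) + card (?W - B)"
    using 1 by blast
  have mono: "card (?W - B) \<le> card (targets A (y # x # zs) - B)"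
    by (intro card_mono) auto
  show ?case
  proof (cases "x \<in> A \<and> y \<noteq> x \<and> exits x (x # zs) < m")
    case True
    have "(\<Sum>v\<in>A. min m (exits v (y # x # zs))) = (\<Sum>v\<in>A. min m (exits v (x # zs)) + (if v = x then 1 else 0))"
      using True by (intro sum.cong) auto
    also have "\<dots> = (\<Sum>v\<in>A. min m (exits v (x # zs))) + 1"
      using 1(3) True by (simp add: sum.distrib)
    finally have eq: "(\<Sum>v\<in>A. min m (exits v (y # x # zs))) = (\<Sum>v\<in>A. min m (exits v (x # zs))) + 1" .
    show ?thesis
    proof (cases "y \<in> B \<union> ?W")
      case True': True
      then show ?thesis using eq IH mono True by simp
    next
      case False
      then have "targets A (y # x # zs) - B = insert y (?W - B)" "y \<notin> ?W - B" using True by auto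
      then have "card (targets A (y # x # zs) - B) = Suc (card (?W - B))" by simp
      then show ?thesis using eq IH by simp
    qed
  next
    case False
    have "(\<Sum>v\<in>A. min m (exits v (y # x # zs))) = (\<Sum>v\<in>A. min m (exits v (x # zs)))"
      using False by (intro sum.cong) auto
    then show ?thesis using IH mono by simp
  qed
qed auto

context walk_graph begin

section \<open>Iterated one-step bounds and the resulting tail bounds\<close>

lemma finite_set_pmf_lazy_step:
  assumes "x \<in> V"
  shows "set_pmf (lazy_step G x) \<subseteq> V" "finite (set_pmf (lazy_step G x))"
proof -
  have "set_pmf (lazy_step G x) \<subseteq> insert x (N x)"
    using set_pmf_of_set[OF N_not_empty[OF assms] finite_N]
    by (auto simp: lazy_step_def split: if_splits)
  then show "set_pmf (lazy_step G x) \<subseteq> V" using N_subset assms by blast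
  then show "finite (set_pmf (lazy_step G x))" by (rule finite_subset) simp
qed

lemma expectation_lazy_step:
  assumes "x \<in> V"
  shows "measure_pmf.expectation (lazy_step G x) f = lazy_op f x"
proof -
  have "measure_pmf.expectation (lazy_step G x) f
      = measure_pmf.expectation (bernoulli_pmf (1/2))
          (\<lambda>b. measure_pmf.expectation (if b then return_pmf x else pmf_of_set (N x)) f)"
    unfolding lazy_step_def using N_not_empty[OF assms]
    by (intro expectation_bind_finite) (auto intro: finite_subset[OF subset_UNIV])
  also have "\<dots> = f x / 2 + (\<Sum>y\<in>N x. f y) / d x / 2"
    using N_not_empty[OF assms] by (simp add: integral_pmf_of_set deg_def)
  finally show ?thesis by (simp add: lazy_op_def)
qed

lemma finite_set_pmf_lazy_walk: "x \<in> V \<Longrightarrow> finite (set_pmf (lazy_walk G L x))"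
proof (induction L arbitrary: x)
  case (Suc L)
  then show ?case using finite_set_pmf_lazy_step[OF Suc.prems] by (auto simp: subset_iff)
qed simp

text \<open>The walk is generated from its start onwards, so the past is carried along in
  \<open>zs\<close>, and the induction must be general in it.\<close>

lemma expectation_lazy_walk_le:
  fixes F :: "nat list \<Rightarrow> real"
  assumes step: "\<And>x zs. x \<in> V \<Longrightarrow> lazy_op (\<lambda>y. F (y # x # zs)) x \<le> \<rho> * F (x # zs)"
    and "0 \<le> \<rho>" "x \<in> V"
  shows "measure_pmf.expectation (lazy_walk G L x) (\<lambda>xs. F (rev xs @ zs)) \<le> \<rho> ^ L * F (x # zs)"
  using \<open>x \<in> V\<close>
proof (induction L arbitrary: x zs)
  case (Suc L)
  have sub: "y \<in> V" if "y \<in> set_pmf (lazy_step G x)" for y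
    using finite_set_pmf_lazy_step[OF Suc.prems] that by blast
  have fin: "finite (set_pmf (lazy_step G x))" by (rule finite_set_pmf_lazy_step[OF Suc.prems])
  have "measure_pmf.expectation (lazy_walk G (Suc L) x) (\<lambda>xs. F (rev xs @ zs))
     = measure_pmf.expectation (lazy_step G x)
         (\<lambda>y. measure_pmf.expectation (lazy_walk G L y) (\<lambda>xs. F (rev xs @ x # zs)))"
    unfolding lazy_walk.simps using finite_set_pmf_lazy_walk sub
    by (subst expectation_bind_finite[OF fin]) auto
  also have "\<dots> \<le> measure_pmf.expectation (lazy_step G x) (\<lambda>y. \<rho> ^ L * F (y # x # zs))"
    using Suc.IH sub
    by (intro integral_mono_AE integrable_measure_pmf_finite fin) (auto simp: AE_measure_pmf_iff)
  also have "\<dots> = \<rho> ^ L * lazy_op (\<lambda>y. F (y # x # zs)) x"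
    using expectation_lazy_step[OF Suc.prems] by simp
  also have "\<dots> \<le> \<rho> ^ L * (\<rho> * F (x # zs))"
    using step[OF Suc.prems] \<open>0 \<le> \<rho>\<close> by (intro mult_left_mono) auto
  finally show ?case by (simp add: mult_ac)
qed simp

text \<open>The potential is a power of \<open>s\<close> counting exits times
  \<open>1 - \<eta> * g\<close>, with \<open>g\<close> the Green function truncated at
  \<open>T\<close>. Away from \<open>v\<close> a step raises the mean of \<open>g\<close> by at
  least \<open>p\<close>; at \<open>v\<close> the factor \<open>s\<close> supplies the decay.
  Markov's inequality concludes.\<close>

lemma prob_few_exits_le:
  fixes p \<eta> s R :: real
  assumes v: "v \<in> V" and x0: "x0 \<in> V"
    and green: "\<And>x. x \<in> V \<Longrightarrow> (\<Sum>t<T. hit_prob v t x) \<le> R"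
    and mix: "\<And>x. x \<in> V \<Longrightarrow> p \<le> hit_prob v T x"
    and "0 \<le> p" "0 < \<eta>" "0 < s" "2 * s \<le> 1 - \<eta> * R" "\<eta> * p \<le> 1/4"
  shows "measure_pmf.prob (lazy_walk G L x0) {xs. exits v (rev xs) < m} \<le> (1 - \<eta> * p) ^ L / (2 * s ^ m)"
proof -
  define g where "g x = (\<Sum>t<T. hit_prob v t x)" for x
  \<comment> \<open>On \<open>V\<close> the maximum is always the second term; the first keeps
    \<open>F\<close> positive at arbitrary lists.\<close>
  define h where "h x = max (2 * s) (1 - \<eta> * g x)" for x
  define F where "F zs = s ^ exits v zs * h (hd zs)" for zs
  have gnn: "0 \<le> g x" for x unfolding g_def by (intro sum_nonneg hit_prob_nonneg)
  have h_ge: "2 * s \<le> h x" for x by (simp add: h_def)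
  have h_nn: "0 \<le> h x" for x using h_ge[of x] \<open>0 < s\<close> by linarith
  have h_eq: "h x = 1 - \<eta> * g x" if "x \<in> V" for x
  proof -
    have "\<eta> * g x \<le> \<eta> * R" using green[OF that] \<open>0 < \<eta>\<close> unfolding g_def by (intro mult_left_mono) auto
    then show ?thesis using \<open>2 * s \<le> 1 - \<eta> * R\<close> by (simp add: h_def)
  qed
  have "0 \<le> R" using gnn[of v] green[OF v] by (simp add: g_def)
  then have "0 \<le> \<eta> * R" using \<open>0 < \<eta>\<close> by simp
  then have s1: "2 * s \<le> 1" using \<open>2 * s \<le> 1 - \<eta> * R\<close> by linarith
  have h_le: "h x \<le> 1" for x using gnn[of x] \<open>0 < \<eta>\<close> s1 by (simp add: h_def)
  have lazy_g: "lazy_op g x = g x + hit_prob v T x" if "x \<noteq> v" for x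
  proof -
    \<comment> \<open>The shift of time drops the term at time 0, which vanishes for
      \<open>x \<noteq> v\<close>, and adds the one at time \<open>T\<close>.\<close>
    have "lazy_op g x = (\<Sum>t<T. hit_prob v (Suc t) x)"
      unfolding g_def lazy_op_sum hit_prob_Suc ..
    also have "\<dots> = g x + hit_prob v T x"
      unfolding g_def using that by (induction T) (simp_all add: hit_prob_0)
    finally show ?thesis .
  qed
  have "measure_pmf.expectation (lazy_walk G L x0) (\<lambda>xs. F (rev xs @ [])) \<le> (1 - \<eta> * p) ^ L * F (x0 # [])"
  proof (rule expectation_lazy_walk_le)
    fix x zs assume x: "x \<in> V"
    let ?e = "s ^ exits v (x # zs)"
    show "lazy_op (\<lambda>y. F (y # x # zs)) x \<le> (1 - \<eta> * p) * F (x # zs)"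
    proof (cases "x = v")
      case True
      have nbr: "F (y # x # zs) = ?e * (s * h y)" if "y \<in> N x" for y
        using N_subset[of x] that True by (auto simp: F_def power_add)
      have "(\<Sum>y\<in>N x. F (y # x # zs)) = (\<Sum>y\<in>N x. ?e * (s * h y))"
        by (intro sum.cong refl nbr)
      also have "\<dots> \<le> (\<Sum>y\<in>N x. ?e * (s * 1))"
        using \<open>0 < s\<close> h_le by (intro sum_mono mult_left_mono) auto
      also have "\<dots> = d x * (?e * s)" by (simp add: deg_def)
      finally have "(\<Sum>y\<in>N x. F (y # x # zs)) / (2 * d x) \<le> d x * (?e * s) / (2 * d x)"
        by (intro divide_right_mono) auto
      then have "lazy_op (\<lambda>y. F (y # x # zs)) x \<le> ?e * (h x / 2 + s / 2)"
        using d_pos[OF x] True by (simp add: lazy_op_def F_def field_simps)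
      also have "\<dots> \<le> ?e * ((1 - \<eta> * p) * h x)"
      proof (rule mult_left_mono)
        \<comment> \<open>Staying contributes \<open>h x / 2\<close> and leaving at most
          \<open>s / 2\<close>. As \<open>h x \<ge> 2 * s\<close> and
          \<open>\<eta> * p \<le> 1/4\<close>, the latter fits into the remaining room.\<close>
        have "2 * s * (1/4) \<le> h x * (1/2 - \<eta> * p)"
          using h_ge[of x] \<open>\<eta> * p \<le> 1/4\<close> \<open>0 < s\<close> by (intro mult_mono) auto
        then show "h x / 2 + s / 2 \<le> (1 - \<eta> * p) * h x" by (simp add: algebra_simps)
      qed (use \<open>0 < s\<close> in auto)
      finally show ?thesis by (simp add: F_def mult_ac)
    next
      case False
      have "lazy_op (\<lambda>y. F (y # x # zs)) x = ?e * lazy_op h x"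
        unfolding lazy_op_cmult[symmetric] using False by (simp add: F_def)
      also have "lazy_op h x = lazy_op (\<lambda>y. 1 + (- \<eta>) * g y) x"
        using x h_eq by (intro lazy_op_cong) auto
      also have "\<dots> = 1 - \<eta> * (g x + hit_prob v T x)"
        unfolding lazy_op_add lazy_op_cmult lazy_op_const[OF x] lazy_g[OF False] by simp
      also have "\<dots> \<le> h x - \<eta> * p"
        using mix[OF x] \<open>0 < \<eta>\<close> by (simp add: h_eq[OF x] algebra_simps)
      also have "\<dots> \<le> (1 - \<eta> * p) * h x"
        using mult_left_mono[OF h_le[of x], of "\<eta> * p"] assms by (simp add: algebra_simps)
      finally show ?thesis using \<open>0 < s\<close> by (simp add: F_def mult_ac)
    qed
  qed (use assms in auto)
  also have "\<dots> \<le> (1 - \<eta> * p) ^ L * 1"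
    using \<open>\<eta> * p \<le> 1/4\<close> h_le by (intro mult_left_mono) (auto simp: F_def)
  finally have le: "measure_pmf.expectation (lazy_walk G L x0) (\<lambda>xs. F (rev xs)) \<le> (1 - \<eta> * p) ^ L" by simp
  have "2 * s ^ m * measure_pmf.prob (lazy_walk G L x0) {xs. exits v (rev xs) < m}
      \<le> measure_pmf.expectation (lazy_walk G L x0) (\<lambda>xs. F (rev xs))"
  proof (rule markov_finite_pmf[OF finite_set_pmf_lazy_walk[OF x0]])
    show "0 \<le> F (rev xs)" for xs using h_nn \<open>0 < s\<close> by (simp add: F_def)
    fix xs assume "xs \<in> {xs. exits v (rev xs) < m}"
    \<comment> \<open>Fewer than \<open>m\<close> exits leave a spare factor \<open>s\<close>, which
      is matched with the lower bound \<open>2 * s\<close> of \<open>h\<close>.\<close>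
    then have "s ^ m \<le> s ^ Suc (exits v (rev xs))"
      using \<open>0 < s\<close> s1 by (intro power_decreasing) auto
    then have "2 * s ^ m \<le> s ^ exits v (rev xs) * (2 * s)" by (simp add: mult_ac)
    also have "\<dots> \<le> F (rev xs)"
      unfolding F_def using h_ge \<open>0 < s\<close> by (intro mult_left_mono) auto
    finally show "2 * s ^ m \<le> F (rev xs)" .
  qed
  then show ?thesis using le \<open>0 < s\<close> by (simp add: field_simps)
qed

text \<open>Targets only accumulate, so each past conditional probability is at most the one for the
  final target set, and \<open>v\<close> is charged at most \<open>min m (exits v zs)\<close>
  times.\<close>

lemma stale_rate_le:
  assumes "finite A" "A \<subseteq> V"
  shows "stale_rate G A B m zs
    \<le> (\<Sum>v\<in>A. real (min m (exits v zs)) * (card (N v \<inter> (B \<union> targets A zs)) / d v))"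
  using assms
proof (induction A B m zs rule: stale_exits.induct)
  case (1 A B m y x zs)
  let ?W = "B \<union> targets A (x # zs)" and ?W' = "B \<union> targets A (y # x # zs)"
  define c where "c v = card (N v \<inter> ?W) / d v" for v
  define c' where "c' v = card (N v \<inter> ?W') / d v" for v
  have c: "c v \<le> c' v" "0 \<le> c v" for v
    unfolding c_def c'_def by (auto intro!: divide_right_mono card_mono)
  have IH: "stale_rate G A B m (x # zs) \<le> (\<Sum>v\<in>A. real (min m (exits v (x # zs))) * c v)"
    using 1 by (simp add: c_def)
  let ?cnt = "x \<in> A \<and> y \<noteq> x \<and> exits x (x # zs) < m"
  have "stale_rate G A B m (y # x # zs) = stale_rate G A B m (x # zs) + (if ?cnt then c x else 0)"
    by (simp add: c_def)
  also have "\<dots> \<le> (\<Sum>v\<in>A. real (min m (exits v (x # zs))) * c v + (if ?cnt \<and> v = x then c v else 0))"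
    using IH 1(2) by (auto simp: sum.distrib)
  also have "\<dots> \<le> (\<Sum>v\<in>A. real (min m (exits v (y # x # zs))) * c' v)"
  proof (intro sum_mono)
    fix v assume "v \<in> A"
    show "real (min m (exits v (x # zs))) * c v + (if ?cnt \<and> v = x then c v else 0)
        \<le> real (min m (exits v (y # x # zs))) * c' v"
    proof (cases "?cnt \<and> v = x")
      case True
      then have "real (min m (exits v (y # x # zs))) = real (min m (exits v (x # zs))) + 1" by auto
      then have "real (min m (exits v (y # x # zs))) * c' v
          \<ge> (real (min m (exits v (x # zs))) + 1) * c v"
        using c[of v] by (simp only:) (intro mult_left_mono, auto)
      then show ?thesis using True by (simp add: algebra_simps)
    next
      case False
      have "real (min m (exits v (x # zs))) * c v \<le> real (min m (exits v (y # x # zs))) * c' v"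
        using c[of v] by (intro mult_mono) auto
      then show ?thesis using False by auto
    qed
  qed
  finally show ?case by (simp add: c'_def)
qed (auto intro!: sum_nonneg)

text \<open>The process \<open>exp (\<theta> \<cdot> stale_exits - e\<^sup>\<theta> \<cdot> stale_rate)\<close> is a supermartingale, because
  \<open>1 + (e\<^sup>\<theta> - 1) q \<le> exp (e\<^sup>\<theta> q)\<close>.\<close>

lemma prob_few_targets_le:
  fixes b S \<theta> :: real
  assumes A: "A \<subseteq> V" "A \<subseteq> B" and x0: "x0 \<in> V" and "0 \<le> \<theta>" "0 \<le> b"
    and rate: "\<And>U. U \<subseteq> V - B \<Longrightarrow> card U \<le> b \<Longrightarrow> (\<Sum>v\<in>A. card (N v \<inter> (B \<union> U)) / d v) \<le> S"
  shows "measure_pmf.prob (lazy_walk G L x0)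
      {xs. (\<forall>v\<in>A. m \<le> exits v (rev xs)) \<and> card (targets A (rev xs) - B) \<le> b}
    \<le> exp (exp \<theta> * m * S - \<theta> * (m * card A - b))"
proof -
  define F where "F zs = exp (\<theta> * stale_exits A B m zs - exp \<theta> * stale_rate G A B m zs)" for zs
  have finA: "finite A" using A finite_subset by blast
  have "measure_pmf.expectation (lazy_walk G L x0) (\<lambda>xs. F (rev xs @ [])) \<le> 1 ^ L * F (x0 # [])"
  proof (rule expectation_lazy_walk_le)
    fix x zs assume x: "x \<in> V"
    let ?W = "B \<union> targets A (x # zs)"
    show "lazy_op (\<lambda>y. F (y # x # zs)) x \<le> 1 * F (x # zs)"
    proof (cases "x \<in> A \<and> exits x (x # zs) < m")
      case True
      \<comment> \<open>The conditional probability that the next exit is stale, given that the walk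
        leaves \<open>x\<close>. A lazy step changes neither of the two counts.\<close>
      define q where "q = card (N x \<inter> ?W) / d x"
      define f where "f y = (if y \<in> ?W then exp \<theta> else 1)" for y
      have nbr: "F (y # x # zs) = F (x # zs) * (exp (- (exp \<theta> * q)) * f y)" if "y \<in> N x" for y
      proof -
        have "y \<noteq> x" using that N_subset by blast
        then show ?thesis using True
          by (simp add: F_def q_def f_def exp_add[symmetric] algebra_simps add_divide_distrib)
      qed
      have same: "F (x # x # zs) = F (x # zs)" by (simp add: F_def)
      have "(\<Sum>y\<in>N x. f y) = (\<Sum>y\<in>N x. 1 + (exp \<theta> - 1) * (if y \<in> ?W then 1 else 0))"
        by (intro sum.cong refl) (simp add: f_def)
      also have "\<dots> = d x + (exp \<theta> - 1) * card (N x \<inter> ?W)"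
        by (simp only: sum.distrib sum_distrib_left[symmetric] sum.inter_restrict[symmetric] finite_N) (simp add: deg_def)
      also have "\<dots> = d x * (1 + (exp \<theta> - 1) * q)"
        using d_pos[OF x] by (simp add: q_def field_simps)
      also have "\<dots> \<le> d x * exp (exp \<theta> * q)"
      proof (rule mult_left_mono)
        have "0 \<le> q" by (simp add: q_def)
        then have "1 + (exp \<theta> - 1) * q \<le> 1 + exp \<theta> * q" by (simp add: algebra_simps)
        then show "1 + (exp \<theta> - 1) * q \<le> exp (exp \<theta> * q)"
          using exp_ge_add_one_self[of "exp \<theta> * q"] by linarith
      qed simp
      finally have sumf: "(\<Sum>y\<in>N x. f y) \<le> d x * exp (exp \<theta> * q)" .
      have "(\<Sum>y\<in>N x. F (y # x # zs)) = F (x # zs) * exp (- (exp \<theta> * q)) * (\<Sum>y\<in>N x. f y)"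
        unfolding sum_distrib_left by (intro sum.cong refl) (simp add: nbr)
      also have "\<dots> \<le> F (x # zs) * exp (- (exp \<theta> * q)) * (d x * exp (exp \<theta> * q))"
        using sumf by (intro mult_left_mono) (auto simp: F_def)
      also have "\<dots> = F (x # zs) * d x" by (simp add: exp_minus)
      finally show ?thesis using d_pos[OF x] by (simp add: lazy_op_def same field_simps)
    next
      case False
      then have "F (y # x # zs) = F (x # zs)" for y by (auto simp: F_def)
      then show ?thesis using lazy_op_const[OF x] by simp
    qed
  qed (use x0 in auto)
  then have le1: "measure_pmf.expectation (lazy_walk G L x0) (\<lambda>xs. F (rev xs)) \<le> 1"
    by (simp add: F_def)
  \<comment> \<open>On the event at least \<open>m * card A - b\<close> exits are stale while the
    accumulated rate is at most \<open>m * S\<close>, so \<open>?c\<close> bounds \<open>F\<close>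
    from below.\<close>
  let ?c = "exp (\<theta> * (m * card A - b) - exp \<theta> * (m * S))"
  have "?c * measure_pmf.prob (lazy_walk G L x0)
      {xs. (\<forall>v\<in>A. m \<le> exits v (rev xs)) \<and> card (targets A (rev xs) - B) \<le> b}
      \<le> measure_pmf.expectation (lazy_walk G L x0) (\<lambda>xs. F (rev xs))"
  proof (rule markov_finite_pmf[OF finite_set_pmf_lazy_walk[OF x0]])
    show "0 \<le> F (rev xs)" for xs by (simp add: F_def)
    fix xs assume "xs \<in> {xs. (\<forall>v\<in>A. m \<le> exits v (rev xs)) \<and> card (targets A (rev xs) - B) \<le> b}"
    then have ex: "\<And>v. v \<in> A \<Longrightarrow> m \<le> exits v (rev xs)" and cb: "card (targets A (rev xs) - B) \<le> b" by auto
    \<comment> \<open>Neighbourhoods lie in \<open>V\<close>, so cutting the targets down to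
      \<open>V\<close> changes no intersection and makes \<open>rate\<close> applicable.\<close>
    define U where "U = targets A (rev xs) \<inter> V - B"
    have "card U \<le> card (targets A (rev xs) - B)" unfolding U_def by (intro card_mono) auto
    then have Ub: "card U \<le> b" using cb by linarith
    have mins: "min m (exits v (rev xs)) = m" if "v \<in> A" for v using ex[OF that] by simp
    have "m * card A \<le> stale_exits A B m (rev xs) + card (targets A (rev xs) - B)"
      using sum_min_exits_le[OF A(2) finA, of m "rev xs"] mins by (simp add: mult.commute)
    then have "real (m * card A) \<le> real (stale_exits A B m (rev xs) + card (targets A (rev xs) - B))"
      by (rule of_nat_mono)
    then have 1: "m * card A - b \<le> stale_exits A B m (rev xs)" using cb by simp
    have "stale_rate G A B m (rev xs)
        \<le> (\<Sum>v\<in>A. real (min m (exits v (rev xs))) * (card (N v \<inter> (B \<union> targets A (rev xs))) / d v))"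
      by (rule stale_rate_le[OF finA A(1)])
    also have "\<dots> = (\<Sum>v\<in>A. real m * (card (N v \<inter> (B \<union> U)) / d v))"
    proof (intro sum.cong refl)
      fix v assume v: "v \<in> A"
      have "N v \<inter> (B \<union> targets A (rev xs)) = N v \<inter> (B \<union> U)" using N_subset[of v] by (auto simp: U_def)
      then show "real (min m (exits v (rev xs))) * (card (N v \<inter> (B \<union> targets A (rev xs))) / d v)
          = real m * (card (N v \<inter> (B \<union> U)) / d v)" by (simp only: mins[OF v])
    qed
    also have "\<dots> = m * (\<Sum>v\<in>A. card (N v \<inter> (B \<union> U)) / d v)" by (simp add: sum_distrib_left)
    also have "\<dots> \<le> m * S" using Ub by (intro mult_left_mono rate) (auto simp: U_def)
    finally have 2: "stale_rate G A B m (rev xs) \<le> m * S" .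
    show "?c \<le> F (rev xs)"
      unfolding F_def exp_le_cancel_iff using 1 2 \<open>0 \<le> \<theta>\<close>
      by (intro diff_mono mult_left_mono) auto
  qed
  then have "?c * measure_pmf.prob (lazy_walk G L x0)
      {xs. (\<forall>v\<in>A. m \<le> exits v (rev xs)) \<and> card (targets A (rev xs) - B) \<le> b} \<le> 1"
    using le1 by linarith
  then have "measure_pmf.prob (lazy_walk G L x0)
      {xs. (\<forall>v\<in>A. m \<le> exits v (rev xs)) \<and> card (targets A (rev xs) - B) \<le> b} \<le> 1 / ?c"
    by (simp add: field_simps)
  also have "1 / ?c = exp (exp \<theta> * m * S - \<theta> * (m * card A - b))"
    by (simp add: exp_minus[symmetric] inverse_eq_divide[symmetric] mult.assoc)
  finally show ?thesis .
qed

section \<open>The truncated Green function\<close>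

lemma lazy_op_mono:
  assumes "x \<in> V" "\<And>y. y \<in> V \<Longrightarrow> f y \<le> g y"
  shows "lazy_op f x \<le> lazy_op g x"
proof -
  have "(\<Sum>y\<in>N x. f y) \<le> (\<Sum>y\<in>N x. g y)"
    using assms(2) N_subset[of x] by (intro sum_mono) blast
  then have "(\<Sum>y\<in>N x. f y) / (2 * d x) \<le> (\<Sum>y\<in>N x. g y) / (2 * d x)"
    by (intro divide_right_mono) auto
  then show ?thesis using assms(2)[OF assms(1)] by (simp add: lazy_op_def)
qed

text \<open>At time 0 the only contributing neighbour is \<open>v\<close> itself. As the operator is
  monotone and fixes constants, the bound is carried to later times.\<close>

lemma hit_prob_Suc_le:
  fixes \<delta> :: real
  assumes deg: "\<And>x. x \<in> V \<Longrightarrow> \<delta> \<le> d x" and \<delta>: "0 < \<delta>" and x: "x \<in> V"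
  shows "hit_prob v (Suc t) x \<le> hit_prob v t x / 2 + 1 / (2 * \<delta>)"
  using x
proof (induction t arbitrary: x)
  case 0
  have "(\<Sum>y\<in>N x. hit_prob v 0 y) \<le> 1"
    by (simp add: hit_prob_0)
  then have "(\<Sum>y\<in>N x. hit_prob v 0 y) / (2 * d x) \<le> 1 / (2 * \<delta>)"
    using deg[OF 0] \<delta> by (intro frac_le) auto
  then show ?case by (simp add: hit_prob_Suc lazy_op_def)
next
  case (Suc t)
  have "hit_prob v (Suc (Suc t)) x \<le> lazy_op (\<lambda>y. 1 / 2 * hit_prob v t y + 1 / (2 * \<delta>)) x"
    using Suc by (subst hit_prob_Suc, intro lazy_op_mono) auto
  also have "\<dots> = hit_prob v (Suc t) x / 2 + 1 / (2 * \<delta>)"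
    unfolding lazy_op_add lazy_op_cmult lazy_op_const[OF Suc.prems] hit_prob_Suc by simp
  finally show ?case .
qed

text \<open>Unrolling the recurrence gives
  \<open>hit_prob v t x \<le> (1/2) ^ t + 1 / \<delta>\<close>. The geometric part sums to at most
  2, the mean length of a lazy sojourn.\<close>

lemma green_le:
  fixes \<delta> :: real
  assumes deg: "\<And>x. x \<in> V \<Longrightarrow> \<delta> \<le> d x" and \<delta>: "0 < \<delta>" and x: "x \<in> V"
  shows "(\<Sum>t<T. hit_prob v t x) \<le> 2 + T / \<delta>"
proof -
  have hit: "hit_prob v t x \<le> (1/2) ^ t + 1 / \<delta>" for t
  proof (induction t)
    case (Suc t)
    have "hit_prob v (Suc t) x \<le> hit_prob v t x / 2 + 1 / \<delta> / 2"
      using hit_prob_Suc_le[OF deg \<delta> x, of v t] by (simp add: divide_divide_eq_left mult.commute)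
    also have "\<dots> \<le> ((1/2) ^ t + 1 / \<delta>) / 2 + 1 / \<delta> / 2" using Suc by simp
    finally show ?case by (simp add: add_divide_distrib)
  qed (use \<delta> in \<open>simp add: hit_prob_0\<close>)
  have "(\<Sum>t<T. (1/2) ^ t :: real) \<le> 2"
  proof -
    have "(\<Sum>t<T. (1/2) ^ t :: real) = 2 - 2 * (1/2) ^ T"
      by (induction T) (simp_all add: field_simps)
    then show ?thesis by simp
  qed
  moreover have "(\<Sum>t<T. hit_prob v t x) \<le> (\<Sum>t<T. (1/2) ^ t + 1 / \<delta>)"
    by (intro sum_mono hit)
  ultimately show ?thesis by (simp add: sum.distrib)
qed

subsection \<open>Edges inside and around small sets\<close>

text \<open>Disjointness gives each edge exactly one orientation from \<open>A\<close> to
  \<open>B\<close>.\<close>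

lemma links_eq_card_edges_between:
  assumes "finite A" "A \<inter> B = {}"
  shows "real (card (edges_between G A B)) = links A B"
proof -
  have "edges_between G A B = (\<lambda>(x, y). {x, y}) ` (SIGMA x:A. N x \<inter> B)"
    by (auto simp: edges_between_def neighbours_def adj_def image_iff)
  moreover have "inj_on (\<lambda>(x, y). {x, y}) (SIGMA x:A. N x \<inter> B)"
    using assms(2) by (auto simp: inj_on_def doubleton_eq_iff)
  ultimately have "card (edges_between G A B) = card (SIGMA x:A. N x \<inter> B)"
    by (simp add: card_image)
  also have "\<dots> = (\<Sum>x\<in>A. card (N x \<inter> B))"
    using assms(1) by simp
  finally show ?thesis by (simp add: links_def)
qed

lemma links_eq_sum:
  assumes "finite B"
  shows "links A B = (\<Sum>x\<in>A. \<Sum>y\<in>B. if y \<in> N x then 1 else 0)"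
  using assms by (simp add: links_def sum.inter_restrict[symmetric] Int_commute)

lemma links_sym:
  assumes "finite A" "finite B"
  shows "links A B = links B A"
  unfolding links_eq_sum[OF assms(1)] links_eq_sum[OF assms(2)]
  by (subst sum.swap) (simp add: neighbours_sym)

lemma links_mono:
  assumes "finite C" "A \<subseteq> C"
  shows "links A B \<le> links C B"
  unfolding links_def using assms by (intro sum_mono2) auto

lemma links_insert:
  assumes "finite A" "finite B" "x \<notin> A"
  shows "links (insert x A) B = card (N x \<inter> B) + links A B"
    and "links B (insert x A) = card (N x \<inter> B) + links B A"
proof -
  show 1: "links (insert x A) B = card (N x \<inter> B) + links A B"
    using assms by (simp add: links_def)
  show "links B (insert x A) = card (N x \<inter> B) + links B A"
    using 1 links_sym[of B "insert x A"] links_sym[of B A] assms by simp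
qed

text \<open>Vertices are added greedily, each on the side that cuts at least half of its edges to
  earlier ones. The factor 4 is 2 for this half times 2 because \<open>links A A\<close> counts
  inner edges in both orientations.\<close>

lemma exists_max_cut:
  assumes "finite A"
  shows "\<exists>C\<subseteq>A. links A A \<le> 4 * links C (A - C)"
  using assms
proof (induction A rule: finite_induct)
  case empty
  then show ?case by (simp add: links_def)
next
  case (insert x A)
  then obtain C where C: "C \<subseteq> A" "links A A \<le> 4 * links C (A - C)" by blast
  have fin: "finite C" "finite (A - C)" using C insert finite_subset by auto
  define k1 where "k1 = card (N x \<inter> C)"
  define k2 where "k2 = card (N x \<inter> (A - C))"
  have "N x \<inter> A = (N x \<inter> C) \<union> (N x \<inter> (A - C))" using C by blast
  then have k: "card (N x \<inter> A) = k1 + k2"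
    unfolding k1_def k2_def by (simp only:) (intro card_Un_disjoint, auto)
  have "N x \<inter> insert x A = N x \<inter> A" using N_subset by blast
  then have total: "links (insert x A) (insert x A) = 2 * (real k1 + k2) + links A A"
    using links_insert(1)[of A "insert x A" x] links_insert(2)[of A A x] insert k by simp
  show ?case
  proof (cases "k1 \<le> k2")
    case True
    have "insert x A - insert x C = A - C" using insert by blast
    then have "links (insert x C) (insert x A - insert x C) = k2 + links C (A - C)"
      using links_insert(1)[OF fin, of x] insert(2) C(1) by (auto simp: k2_def)
    then show ?thesis using total C True by (intro exI[of _ "insert x C"]) auto
  next
    case False
    have "insert x A - C = insert x (A - C)" using insert C by blast
    then have "links C (insert x A - C) = k1 + links C (A - C)"
      using links_insert(2)[OF fin(2,1), of x] insert by (simp add: k1_def)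
    then show ?thesis using total C False by (intro exI[of _ C]) auto
  qed
qed

text \<open>Merges the two size ranges of the codegree condition. The threshold is \<open>K\<close>
  for the smallest sets and proportional to \<open>card A\<close> otherwise. Both are at most
  \<open>K * a\<close>, the latter by \<open>card A * ln n \<le> n\<close>; and
  \<open>ln K \<le> K\<close> leads to a common bound.\<close>

lemma codegree_threshold:
  fixes K a :: real
  assumes code: "codegree_cond K a n G" and K: "1 < K" and a: "1 \<le> a" and n: "2 \<le> n"
    and A: "A \<subseteq> V" "A \<noteq> {}" "card A \<le> n / ln n"
  obtains \<tau> :: real where "0 < \<tau>" "\<tau> \<le> K * a"
    "links A {u \<in> V - A. \<tau> \<le> card (N u \<inter> A)} \<le> card A * a * ln n / ln K"
proof -
  have finA: "finite A" using A finite_subset by blast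
  have cA: "card A > 0" using finA A by auto
  have lnn: "ln (real n) > 0" using n by simp
  have lnK: "ln K > 0" "ln K \<le> K" using K ln_bound[of K] by auto
  \<comment> \<open>A positive threshold forces a neighbour in \<open>A\<close>, so
    \<open>ext_nbhd G A\<close> may be replaced by \<open>V - A\<close>.\<close>
  have conv: "real (card (edges_between G A {u \<in> ext_nbhd G A. \<tau> \<le> real (card (edges_between G {u} A))}))
      = links A {u \<in> V - A. \<tau> \<le> card (N u \<inter> A)}" if "\<tau> > 0" for \<tau>
  proof -
    have one: "real (card (edges_between G {u} A)) = card (N u \<inter> A)" if "u \<notin> A" for u
      using links_eq_card_edges_between[of "{u}" A] that by (simp add: links_def)
    have "u \<in> ext_nbhd G A" if "u \<notin> A" "\<tau> \<le> card (N u \<inter> A)" for u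
    proof -
      have "card (N u \<inter> A) \<noteq> 0" using that \<open>\<tau> > 0\<close> by linarith
      then obtain w where "w \<in> N u" "w \<in> A" by (metis IntE card.empty ex_in_conv)
      then show ?thesis using that by (auto simp: ext_nbhd_def neighbours_def)
    qed
    moreover have "u \<in> V - A" if "u \<in> ext_nbhd G A" for u
      using that N_subset neighbours_sym[of u G]
      by (fastforce simp: ext_nbhd_def neighbours_def adj_def insert_commute)
    ultimately have "{u \<in> ext_nbhd G A. \<tau> \<le> real (card (edges_between G {u} A))}
        = {u \<in> V - A. \<tau> \<le> card (N u \<inter> A)}"
      using one by auto
    then show ?thesis using links_eq_card_edges_between[OF finA] by auto
  qed
  have code': "(real n / (a * ln (real n)) \<le> real (card A) \<longrightarrow>
           real (card (edges_between G A
             {u \<in> ext_nbhd G A. K * real (card A) * a * ln (real n) / real n \<le> real (card (edges_between G {u} A))}))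
             \<le> real (card A) * a * ln (real n) / K) \<and>
        (real (card A) < real n / (a * ln (real n)) \<longrightarrow>
           real (card (edges_between G A
             {u \<in> ext_nbhd G A. K \<le> real (card (edges_between G {u} A))}))
             \<le> real (card A) * a * ln (real n) / ln K)"
    using code A unfolding codegree_cond_def by blast
  show ?thesis
  proof (cases "real n / (a * ln (real n)) \<le> real (card A)")
    case True
    define \<tau> where "\<tau> = K * real (card A) * a * ln (real n) / real n"
    have pos: "0 < \<tau>" using cA K a lnn n by (simp add: \<tau>_def)
    have "card A * ln n \<le> n" using A(3) lnn by (simp add: field_simps)
    then have "K * a * (card A * ln n) \<le> K * a * n" using K a by (intro mult_left_mono) auto
    then have le: "\<tau> \<le> K * a" using n by (simp add: \<tau>_def field_simps)
    have "links A {u \<in> V - A. \<tau> \<le> card (N u \<inter> A)} \<le> card A * a * ln n / K"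
      using code' True conv[OF pos] by (simp add: \<tau>_def)
    also have "\<dots> \<le> card A * a * ln n / ln K"
      using lnK lnn a by (intro divide_left_mono) auto
    finally show ?thesis using that pos le by blast
  next
    case False
    have "links A {u \<in> V - A. K \<le> card (N u \<inter> A)} \<le> card A * a * ln n / ln K"
      using code' False conv[of K] K by simp
    moreover have "K \<le> K * a" using K a by simp
    ultimately show ?thesis using that[of K] K by auto
  qed
qed

lemma links_le_threshold:
  fixes \<tau> :: real
  assumes "\<And>u. u \<in> U \<Longrightarrow> card (N u \<inter> A) \<le> \<tau>"
  shows "links U A \<le> card U * \<tau>"
  unfolding links_def by (rule sum_bounded_above) (rule assms)

text \<open>The codegree condition only sees vertices outside a set, so it is applied to one side
  \<open>C\<close> of a cut of \<open>A\<close>. It controls the opposite vertices of codegree at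
  least \<open>\<tau>\<close>; every other one has fewer than \<open>\<tau>\<close> neighbours in
  \<open>C\<close>.\<close>

lemma links_inside_le:
  fixes K a :: real
  assumes code: "codegree_cond K a n G" and K: "1 < K" and a: "1 \<le> a" and n: "2 \<le> n"
    and A: "A \<subseteq> V" "card A \<le> n / ln n"
  shows "links A A \<le> 4 * (card A * a * ln n / ln K + card A * (K * a))"
proof -
  have finA: "finite A" using A finite_subset by blast
  have lnn: "ln (real n) > 0" using n by simp
  have lnK: "ln K > 0" using K by auto
  obtain C where C: "C \<subseteq> A" "links A A \<le> 4 * links C (A - C)" using exists_max_cut[OF finA] by blast
  have finC: "finite C" using C finA finite_subset by blast
  have cC: "card C \<le> card A" "card (A - C) \<le> card A" using C finA by (auto intro: card_mono)
  have "links C (A - C) \<le> card A * a * ln n / ln K + card A * (K * a)"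
  proof (cases "C = {}")
    case True
    then have "links C (A - C) = 0" by (simp add: links_def)
    then show ?thesis using K a lnn lnK by simp
  next
    case False
    have "card C \<le> n / ln n" using A(2) cC by linarith
    then obtain \<tau> :: real where \<tau>: "0 < \<tau>" "\<tau> \<le> K * a"
      "links C {u \<in> V - C. \<tau> \<le> card (N u \<inter> C)} \<le> card C * a * ln n / ln K"
      using codegree_threshold[OF code K a n, of C] False C(1) A(1) by blast
    define H where "H = {u \<in> V - C. \<tau> \<le> card (N u \<inter> C)}"
    have finH: "finite H" by (simp add: H_def)
    have "links C (A - C) = links (A - C) C" using finA finC by (intro links_sym) auto
    also have "\<dots> \<le> links ((A - C - H) \<union> H) C" using finA finH by (intro links_mono) auto
    also have "\<dots> = links (A - C - H) C + links H C"
      unfolding links_def using finA finH by (intro sum.union_disjoint) auto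
    also have "links (A - C - H) C \<le> card (A - C - H) * \<tau>"
      using finA A(1) by (intro links_le_threshold) (auto simp: H_def)
    also have "links H C = links C H" by (intro links_sym finH finC)
    also have "card (A - C - H) * \<tau> \<le> card A * (K * a)"
    proof (intro mult_mono)
      show "real (card (A - C - H)) \<le> real (card A)" using finA by (intro of_nat_mono card_mono) auto
    qed (use \<tau> in auto)
    also have "links C H \<le> card C * a * ln n / ln K" using \<tau>(3) by (simp add: H_def)
    also have "\<dots> \<le> card A * a * ln n / ln K"
      using cC lnn lnK a by (intro divide_right_mono mult_right_mono) auto
    finally show ?thesis by simp
  qed
  then have "4 * links C (A - C) \<le> 4 * (card A * a * ln n / ln K + card A * (K * a))"
    by (intro mult_left_mono) auto
  with C(2) show ?thesis by (rule order.trans)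
qed

text \<open>Here \<open>B\<close> is \<open>A\<close> together with the vertices \<open>H\<close> of
  large codegree. Edges inside \<open>A\<close> give the terms with factor 4, those to
  \<open>H\<close> raise \<open>4 / ln K\<close> to \<open>5 / ln K\<close>, and each of at most
  \<open>b\<close> other targets has fewer than \<open>\<tau> \<le> K * a\<close> neighbours in
  \<open>A\<close>. The factor \<open>6/5\<close> comes from the minimum degree.\<close>

lemma prob_small_neighbourhood_le:
  fixes K a \<theta> b :: real
  assumes code: "codegree_cond K a n G" and K: "1 < K" and a: "1 \<le> a" and n: "2 \<le> n"
    and A: "A \<subseteq> V" "A \<noteq> {}" "card A \<le> n / ln n" and x0: "x0 \<in> V" and "0 \<le> \<theta>" "0 \<le> b"
    and deg: "\<And>x. x \<in> V \<Longrightarrow> 5 * a / 6 * ln n \<le> d x"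
  shows "measure_pmf.prob (lazy_walk G L x0)
      {xs. (\<forall>v\<in>A. m \<le> exits v (rev xs)) \<and> card (mg_ext_nbhd (walk_trace xs) A) \<le> b}
    \<le> exp (exp \<theta> * m * (6/5 * (5 * card A / ln K + 4 * K * card A / ln n + b * K / ln n))
          - \<theta> * (m * card A - b))"
proof -
  have finA: "finite A" using A finite_subset by blast
  have lnn: "ln (real n) > 0" using n by simp
  have lnK: "ln K > 0" using K by auto
  obtain \<tau> :: real where \<tau>: "0 < \<tau>" "\<tau> \<le> K * a"
      "links A {u \<in> V - A. \<tau> \<le> card (N u \<inter> A)} \<le> card A * a * ln n / ln K"
    using codegree_threshold[OF code K a n A] by blast
  define H where "H = {u \<in> V - A. \<tau> \<le> card (N u \<inter> A)}"
  have finH: "finite H" by (simp add: H_def)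
  define \<delta> where "\<delta> = 5 * a / 6 * ln n"
  have \<delta>: "\<delta> > 0" using a lnn by (simp add: \<delta>_def)
  let ?B = "A \<union> H"
  let ?S = "6/5 * (5 * card A / ln K + 4 * K * card A / ln n + b * K / ln n)"
  have "measure_pmf.prob (lazy_walk G L x0)
      {xs. (\<forall>v\<in>A. m \<le> exits v (rev xs)) \<and> card (mg_ext_nbhd (walk_trace xs) A) \<le> b}
    \<le> measure_pmf.prob (lazy_walk G L x0)
      {xs. (\<forall>v\<in>A. m \<le> exits v (rev xs)) \<and> card (targets A (rev xs) - ?B) \<le> b}"
  proof (intro measure_pmf.finite_measure_mono, safe)
    fix xs assume le: "card (mg_ext_nbhd (walk_trace xs) A) \<le> b"
    have "card (targets A (rev xs) - ?B) \<le> card (mg_ext_nbhd (walk_trace xs) A)"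
      using targets_subset_ext_nbhd[of A xs] by (intro card_mono finite_ext_nbhd_trace) auto
    then show "card (targets A (rev xs) - ?B) \<le> b" using le by linarith
  qed simp
  also have "\<dots> \<le> exp (exp \<theta> * m * ?S - \<theta> * (m * card A - b))"
  proof (rule prob_few_targets_le)
    fix U assume U: "U \<subseteq> V - ?B" "card U \<le> b"
    have finU: "finite U" using U finite_subset[OF U(1)] by simp
    have "(\<Sum>v\<in>A. card (N v \<inter> (?B \<union> U)) / d v)
        \<le> (\<Sum>v\<in>A. (card (N v \<inter> A) + card (N v \<inter> H) + card (N v \<inter> U)) / \<delta>)"
    proof (intro sum_mono frac_le)
      fix v assume "v \<in> A"
      then show "\<delta> \<le> d v" using deg A(1) by (auto simp: \<delta>_def)
      have "N v \<inter> (?B \<union> U) = (N v \<inter> A) \<union> (N v \<inter> H) \<union> (N v \<inter> U)" by blast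
      then have "card (N v \<inter> (?B \<union> U)) \<le> card (N v \<inter> A) + card (N v \<inter> H) + card (N v \<inter> U)"
        using card_Un_le[of "(N v \<inter> A) \<union> (N v \<inter> H)" "N v \<inter> U"] card_Un_le[of "N v \<inter> A" "N v \<inter> H"]
        by simp
      then show "real (card (N v \<inter> (?B \<union> U))) \<le> real (card (N v \<inter> A) + card (N v \<inter> H) + card (N v \<inter> U))"
        by (rule of_nat_mono)
    qed (use \<delta> in auto)
    also have "\<dots> = (links A A + links A H + links A U) / \<delta>"
      by (simp add: links_def sum.distrib sum_divide_distrib[symmetric])
    also have "\<dots> \<le> (4 * (card A * a * ln n / ln K + card A * (K * a)) + card A * a * ln n / ln K + b * (K * a)) / \<delta>"
    proof (intro divide_right_mono add_mono)
      show "links A A \<le> 4 * (card A * a * ln n / ln K + card A * (K * a))"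
        by (rule links_inside_le[OF code K a n A(1,3)])
      show "links A H \<le> card A * a * ln n / ln K" using \<tau>(3) by (simp add: H_def)
      have "links A U = links U A" by (intro links_sym finA finU)
      also have "\<dots> \<le> card U * \<tau>"
        using U by (intro links_le_threshold) (auto simp: H_def)
      also have "\<dots> \<le> b * (K * a)" using U \<tau> \<open>0 \<le> b\<close> by (intro mult_mono) auto
      finally show "links A U \<le> b * (K * a)" .
    qed (use \<delta> in auto)
    also have "\<dots> = ?S" using a lnn lnK by (simp add: \<delta>_def field_simps)
    finally show "(\<Sum>v\<in>A. card (N v \<inter> (?B \<union> U)) / d v) \<le> ?S" .
  qed (use A x0 \<open>0 \<le> \<theta>\<close> \<open>0 \<le> b\<close> in auto)
  finally show ?thesis .
qed

end

subsection \<open>Walks on pseudo-random graphs\<close>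

text \<open>The binomial theorem over subsets, for the union bound over all sets
  \<open>A\<close>.\<close>

lemma sum_Pow_power_card:
  assumes "finite V"
  shows "(\<Sum>A\<in>Pow V. c ^ card A) = (1 + c :: real) ^ card V"
  using assms
proof (induction V rule: finite_induct)
  case (insert x V)
  have "(\<Sum>A\<in>insert x ` Pow V. c ^ card A) = (\<Sum>A\<in>Pow V. c ^ card (insert x A))"
  proof (subst sum.reindex)
    show "inj_on (insert x) (Pow V)" using insert(2) by (intro inj_onI) (metis Diff_insert_absorb PowD subsetD)
  qed simp
  also have "\<dots> = (\<Sum>A\<in>Pow V. c * c ^ card A)"
    using insert by (intro sum.cong refl) (auto simp: card_insert_if finite_subset subset_iff)
  finally have "(\<Sum>A\<in>insert x ` Pow V. c ^ card A) = c * (1 + c) ^ card V"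
    using insert by (simp add: sum_distrib_left[symmetric])
  moreover have "Pow V \<inter> insert x ` Pow V = {}" using insert by auto
  ultimately show ?case
    using insert by (simp add: Pow_insert sum.union_disjoint algebra_simps)
qed simp

context walk_graph begin

text \<open>With \<open>r = sqrt a\<close> the degrees give at least
  \<open>(r - 2) / (r + 2) / n\<close>, and
  \<open>(1 - 4 / r) * (r + 2) \<le> r - 2\<close>.\<close>

lemma stationary_ge:
  assumes deg: "degree_cond a n G" and a: "4 < a" and n: "2 \<le> n" and v: "v \<in> V"
  shows "(1 - 4 / sqrt a) / n \<le> d v / (\<Sum>x\<in>V. d x)"
proof -
  define r where "r = sqrt a"
  have r: "r > 2" "a = r * r" using a real_less_rsqrt[of 2 a] by (auto simp: r_def)
  have l: "ln (real n) > 0" using n by simp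
  define l where "l = ln (real n)"
  have bd: "\<bar>d x - r * r * l\<bar> \<le> 2 * r * l" if "x \<in> V" for x
  proof -
    have "\<bar>d x - a * l\<bar> \<le> 2 * sqrt a * l" using deg that unfolding degree_cond_def l_def by blast
    then show ?thesis unfolding r_def[symmetric] r(2)[symmetric] .
  qed
  have D: "(\<Sum>x\<in>V. d x) \<le> n * ((r * r + 2 * r) * l)"
  proof -
    have "d x \<le> (r * r + 2 * r) * l" if "x \<in> V" for x
      using bd[OF that] by (simp add: abs_le_iff algebra_simps)
    then show ?thesis using sum_bounded_above[of V d "(r * r + 2 * r) * l"] by simp
  qed
  have "(1 - 4 / r) / n * (\<Sum>x\<in>V. d x) \<le> d v"
  proof (cases "1 - 4 / r \<ge> 0")
    case True
    have "(1 - 4 / r) / n * (\<Sum>x\<in>V. d x) \<le> (1 - 4 / r) / n * (n * ((r * r + 2 * r) * l))"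
      using True by (intro mult_left_mono D) auto
    also have "\<dots> = (r * r - 2 * r) * l - 8 * l"
      using r n by (simp add: field_simps)
    also have "\<dots> \<le> (r * r - 2 * r) * l" using l by (simp add: l_def)
    also have "\<dots> \<le> d v" using bd[OF v] by (simp add: abs_le_iff algebra_simps)
    finally show ?thesis .
  next
    case False
    then have "(1 - 4 / r) / n * (\<Sum>x\<in>V. d x) \<le> 0"
      by (intro mult_nonpos_nonneg) (auto simp: divide_nonpos_nonneg sum_nonneg)
    then show ?thesis by simp
  qed
  moreover have "(\<Sum>x\<in>V. d x) > 0" using v d_pos by (intro sum_pos) auto
  ultimately show ?thesis by (simp add: pos_le_divide_eq r_def)
qed

text \<open>The complement of \<open>S\<close> has at least \<open>n / 2\<close> vertices, which
  yields the factor \<open>1/4\<close>.\<close>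

lemma links_boundary_ge:
  assumes bdry: "boundary_cond a n G" and a: "0 \<le> a" and n: "2 \<le> n"
    and S: "S \<subseteq> V" "S \<noteq> {}" "2 * card S \<le> n"
  shows "a * ln n / 4 * card S \<le> links S (V - S)"
proof -
  have finS: "finite S" using S finite_subset by blast
  have half: "real (card (V - S)) \<ge> n / 2" using S finS by (simp add: card_Diff_subset)
  have l: "ln (real n) > 0" using n by simp
  have "real (card S) \<le> 0.8 * real n" using S(3) by simp
  then have "real (card (edges_between G S (V - S)))
      > real (card S) * real (card (V - S)) * a * ln (real n) / (2 * real n)"
    using bdry S unfolding boundary_cond_def by blast
  moreover have "real (card (edges_between G S (V - S))) = links S (V - S)"
    using finS by (intro links_eq_card_edges_between) auto
  moreover have "real (card S) * (n / 2) * a * ln (real n) / (2 * real n)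
      \<le> real (card S) * real (card (V - S)) * a * ln (real n) / (2 * real n)"
    using half l a by (intro divide_right_mono mult_right_mono mult_left_mono) auto
  moreover have "real (card S) * (n / 2) * a * ln (real n) / (2 * real n) = a * ln n / 4 * card S"
    using n by simp
  ultimately show ?thesis by linarith
qed

text \<open>In the exponent, 1 pays for the later union over all \<open>v\<close>, and the surplus
  \<open>\<epsilon> / 6\<close> pays for the denominator.\<close>

lemma prob_exits_less_le:
  fixes \<epsilon> a :: real
  assumes deg: "degree_cond a n G" and bdry: "boundary_cond a n G"
    and \<epsilon>: "0 < \<epsilon>" "\<epsilon> \<le> 1/100" and a: "1500 / \<epsilon>\<^sup>2 \<le> a"
    and n: "2 \<le> n" "1 \<le> ln (real n)" "40 \<le> \<epsilon> * real n ^ 3"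
    and v: "v \<in> V" and x0: "x0 \<in> V"
  shows "measure_pmf.prob (lazy_walk G (walk_length \<epsilon> n) x0) {xs. exits v (rev xs) < m}
    \<le> exp 1 * real n powr (- (1 + \<epsilon> / 6)) / (2 * (\<epsilon> / 40) ^ m)"
proof -
  define l where "l = ln (real n)"
  \<comment> \<open>The ratio of cut bound to maximum degree is \<open>3/16\<close>, so each step
    contracts by \<open>1 - 9/1024\<close>. As \<open>1000 * 9 / 1024 > 8\<close>, the error after
    \<open>T\<close> steps is at most \<open>2 / n ^ 4\<close>, below
    \<open>\<epsilon> / 20 / n\<close> for large \<open>n\<close>.\<close>
  define T where "T = nat \<lceil>1000 * l\<rceil>"
  \<comment> \<open>Chosen so that \<open>1 - \<eta> * R \<ge> \<epsilon> / 20\<close>, which allows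
    \<open>s = \<epsilon> / 40\<close>. In \<open>p\<close>, the loss \<open>\<epsilon> / 5\<close>
    covers \<open>\<epsilon> / 9\<close> for irregular degrees and \<open>\<epsilon> / 20\<close>
    for the mixing error.\<close>
  define \<eta> where "\<eta> = 1/2 - \<epsilon> / 20"
  define p where "p = (1 - \<epsilon> / 5) / n"
  define R where "R = 2 + \<epsilon> / 100"
  have npos: "real n > 0" using n by simp
  have l1: "l \<ge> 1" using n by (simp add: l_def)
  have "1500 \<le> a * \<epsilon>\<^sup>2" using a \<epsilon> by (simp add: field_simps)
  have e2: "\<epsilon>\<^sup>2 \<le> (1/100)\<^sup>2" using \<epsilon> by (intro power_mono) auto
  have "1500 / (1/100)\<^sup>2 \<le> 1500 / \<epsilon>\<^sup>2" using e2 \<epsilon> by (intro divide_left_mono) auto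
  then have abig: "a \<ge> 15000000" using a by (simp add: power2_eq_square)
  have sqrta: "4 / sqrt a \<le> \<epsilon> / 9"
  proof -
    have "(36 / \<epsilon>)\<^sup>2 = 1296 / \<epsilon>\<^sup>2" by (simp add: power_divide)
    also have "\<dots> \<le> 1500 / \<epsilon>\<^sup>2" by (intro divide_right_mono) auto
    also have "\<dots> \<le> a" by (rule a)
    finally have "36 / \<epsilon> \<le> sqrt a" by (rule real_le_rsqrt)
    then show ?thesis using \<epsilon> abig by (simp add: field_simps)
  qed
  have degs: "5 * a / 6 * l \<le> d x" "d x \<le> 4 * a / 3 * l" if "x \<in> V" for x
    using deg that by (auto simp: degree_cond_def l_def)
  have \<delta>pos: "0 < 5 * a / 6 * l" using abig l1 by simp
  have mix: "p \<le> hit_prob v T x" if x: "x \<in> V" for x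
  proof -
    define \<pi> where "\<pi> = d v / (\<Sum>y\<in>V. d y)"
    have "(hit_prob v T x - \<pi>)\<^sup>2 \<le> (1 - ((a * l / 4) / (4 * a / 3 * l))\<^sup>2 / 4) ^ T * ((4 * a / 3 * l) / (5 * a / 6 * l))"
      unfolding \<pi>_def
    proof (rule hit_prob_mixing[OF v x])
      show "a * l / 4 * card S \<le> links S (V - S)" if "S \<subseteq> V" "S \<noteq> {}" "2 * card S \<le> n" for S
        using links_boundary_ge[OF bdry _ n(1) that] abig by (simp add: l_def)
    qed (use degs \<delta>pos abig l1 in auto)
    also have "(a * l / 4) / (4 * a / 3 * l) = 3/16" using abig l1 by simp
    also have "(4 * a / 3 * l) / (5 * a / 6 * l) = 8/5" using abig l1 by simp
    also have "(1 - (3/16)\<^sup>2 / 4 :: real) ^ T \<le> exp (- 8 * l)"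
    proof -
      have "(1 - (3/16)\<^sup>2 / 4 :: real) = 1 + (- 9/1024)" by (simp add: power2_eq_square)
      also have "(1 + (- 9/1024 :: real)) ^ T \<le> exp (- 9/1024) ^ T"
        using exp_ge_add_one_self[of "- 9/1024"] by (intro power_mono) auto
      also have "\<dots> = exp (T * (- 9/1024))" by (rule exp_of_nat_mult[symmetric])
      also have "\<dots> \<le> exp (- 8 * l)"
      proof -
        have "real T \<ge> 1000 * l" by (simp add: T_def of_nat_ceiling)
        then show ?thesis using l1 by simp
      qed
      finally show ?thesis .
    qed
    finally have "(hit_prob v T x - \<pi>)\<^sup>2 \<le> exp (- 8 * l) * (8/5)" by simp
    also have "\<dots> \<le> (2 * exp (- 4 * l))\<^sup>2"
      by (simp add: power_mult_distrib exp_double[symmetric])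
    finally have "\<bar>hit_prob v T x - \<pi>\<bar> \<le> 2 * exp (- 4 * l)"
      by (metis abs_le_square_iff abs_of_nonneg exp_ge_zero mult_nonneg_nonneg zero_le_numeral)
    moreover have "exp (- 4 * l) = 1 / real n ^ 4"
    proof -
      have "exp (- 4 * l) = inverse (exp (of_nat 4 * l))" by (simp add: exp_minus[symmetric])
      also have "\<dots> = 1 / real n ^ 4" unfolding exp_of_nat_mult using npos by (simp add: l_def inverse_eq_divide)
      finally show ?thesis .
    qed
    moreover have "2 / real n ^ 4 \<le> \<epsilon> / 20 / n"
      using n(3) npos by (simp add: field_simps power_numeral_reduce)
    moreover have "(1 - 4 / sqrt a) / n \<le> \<pi>"
      unfolding \<pi>_def using stationary_ge[OF deg _ n(1) v] abig by simp
    moreover have "(1 - \<epsilon> / 9) / n \<le> (1 - 4 / sqrt a) / n"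
      using sqrta by (intro divide_right_mono) auto
    moreover have "p \<le> (1 - \<epsilon> / 9) / n - \<epsilon> / 20 / n"
      unfolding p_def diff_divide_distrib[symmetric] using \<epsilon> by (intro divide_right_mono) auto
    ultimately show ?thesis by linarith
  qed
  have green: "(\<Sum>t<T. hit_prob v t x) \<le> R" if x: "x \<in> V" for x
  proof -
    have "(\<Sum>t<T. hit_prob v t x) \<le> 2 + T / (5 * a / 6 * l)"
      by (rule green_le[OF degs(1) \<delta>pos x])
    moreover have "T / (5 * a / 6 * l) \<le> \<epsilon> / 100"
    proof -
      have "real T \<le> 1000 * l + 1" using l1 by (simp add: T_def)
      then have T: "real T \<le> 1250 * l" using l1 by linarith
      \<comment> \<open>As \<open>T \<le> 1250 * l\<close>, the quotient is at most
        \<open>1500 / a \<le> \<epsilon>\<^sup>2 \<le> \<epsilon> / 100\<close>.\<close>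
      have "1500 \<le> \<epsilon> * (a * \<epsilon>)" using \<open>1500 \<le> a * \<epsilon>\<^sup>2\<close> by (simp add: power2_eq_square mult_ac)
      also have "\<dots> \<le> 1/100 * (a * \<epsilon>)" using \<epsilon> abig by (intro mult_right_mono) auto
      finally have "150000 \<le> a * \<epsilon>" by simp
      then have "1250 * l \<le> \<epsilon> / 100 * (5 * a / 6 * l)" using l1 by (simp add: mult.commute)
      then show ?thesis using T \<delta>pos by (subst pos_divide_le_eq) linarith+
    qed
    ultimately show ?thesis by (simp add: R_def)
  qed
  have \<eta>: "0 < \<eta>" "\<eta> \<le> 1/2" using \<epsilon> by (auto simp: \<eta>_def)
  have p: "0 \<le> p" "p \<le> 1 / n" using \<epsilon> npos by (auto simp: p_def intro!: divide_right_mono)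
  have "1 / real n \<le> 1 / 2" using n(1) by (intro divide_left_mono) auto
  then have \<eta>p: "\<eta> * p \<le> 1/4" using mult_mono[OF \<eta>(2), of p "1/2"] p by simp
  have main: "measure_pmf.prob (lazy_walk G (walk_length \<epsilon> n) x0) {xs. exits v (rev xs) < m}
      \<le> (1 - \<eta> * p) ^ walk_length \<epsilon> n / (2 * (\<epsilon> / 40) ^ m)"
  proof (rule prob_few_exits_le[OF v x0 green mix p(1) \<eta>(1)])
    have "1 - \<eta> * R = \<epsilon> / 20 + \<epsilon> * (1/20 - 1/200) + \<epsilon>\<^sup>2 / 2000"
      by (simp add: \<eta>_def R_def power2_eq_square algebra_simps)
    moreover have "0 \<le> \<epsilon> * (1/20 - 1/200) + \<epsilon>\<^sup>2 / 2000"
      using \<epsilon> by (intro add_nonneg_nonneg) auto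
    ultimately have "\<epsilon> / 20 \<le> 1 - \<eta> * R" by linarith
    then show "2 * (\<epsilon> / 40) \<le> 1 - \<eta> * R" by simp
  qed (use \<epsilon> \<eta>p in auto)
  have "(1 - \<eta> * p) ^ walk_length \<epsilon> n \<le> exp (- (\<eta> * p)) ^ walk_length \<epsilon> n"
    using exp_ge_add_one_self[of "- (\<eta> * p)"] \<eta>p by (intro power_mono) auto
  also have "\<dots> = exp (- (\<eta> * p * walk_length \<epsilon> n))"
    by (simp add: exp_of_nat_mult[symmetric] mult.commute)
  also have "\<dots> \<le> exp (1 - (1 + \<epsilon> / 6) * l)"
  proof -
    have "0 \<le> (2 + \<epsilon>) * n * l" using \<epsilon> l1 by simp
    \<comment> \<open>Rounding costs at most one step, that is, at most a factor
      \<open>exp 1\<close> in the bound.\<close>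
    then have "real (walk_length \<epsilon> n) \<ge> (2 + \<epsilon>) * n * l - 1"
      unfolding walk_length_def l_def by linarith
    then have "\<eta> * p * ((2 + \<epsilon>) * n * l - 1) \<le> \<eta> * p * walk_length \<epsilon> n"
      using \<eta> p by (intro mult_left_mono) auto
    moreover have "\<eta> * p * ((2 + \<epsilon>) * n * l - 1) \<ge> (1 + \<epsilon> / 6) * l - 1"
    proof -
      have "\<eta> * p * ((2 + \<epsilon>) * n * l) = (1 - \<epsilon> / 10) * (1 - \<epsilon> / 5) * (1 + \<epsilon> / 2) * l"
        using npos by (simp add: \<eta>_def p_def field_simps)
      also have "(1 - \<epsilon> / 10) * (1 - \<epsilon> / 5) * (1 + \<epsilon> / 2) * l \<ge> (1 + \<epsilon> / 6) * l"
      proof (rule mult_right_mono)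
        \<comment> \<open>The first-order gain is \<open>1/2 - 1/10 - 1/5 = 1/5\<close>, of which
          \<open>1/6\<close> survives the second-order loss.\<close>
        have "(1 - \<epsilon> / 10) * (1 - \<epsilon> / 5) * (1 + \<epsilon> / 2) = 1 + \<epsilon> / 5 - 13/100 * (\<epsilon> * \<epsilon>) + \<epsilon> * (\<epsilon> * \<epsilon>) / 100"
          by (simp add: field_simps)
        moreover have "\<epsilon> * \<epsilon> \<le> \<epsilon> * (1/100)" using \<epsilon> by (intro mult_left_mono) auto
        moreover have "0 \<le> \<epsilon> * (\<epsilon> * \<epsilon>)" using \<epsilon> by simp
        ultimately show "1 + \<epsilon> / 6 \<le> (1 - \<epsilon> / 10) * (1 - \<epsilon> / 5) * (1 + \<epsilon> / 2)" using \<epsilon> by linarith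
      qed (use l1 in simp)
      finally have "\<eta> * p * ((2 + \<epsilon>) * n * l) \<ge> (1 + \<epsilon> / 6) * l" .
      then show ?thesis using \<eta>p by (simp add: right_diff_distrib)
    qed
    ultimately show ?thesis by simp
  qed
  also have "\<dots> = exp 1 * real n powr (- (1 + \<epsilon> / 6))"
    using npos by (simp add: powr_def l_def exp_add[symmetric] algebra_simps)
  finally have "(1 - \<eta> * p) ^ walk_length \<epsilon> n / (2 * (\<epsilon> / 40) ^ m)
      \<le> exp 1 * real n powr (- (1 + \<epsilon> / 6)) / (2 * (\<epsilon> / 40) ^ m)"
    using \<epsilon> by (intro divide_right_mono) auto
  then show ?thesis using main by linarith
qed

text \<open>A union bound: on failure either some vertex is left too rarely, or all vertices of some
  set \<open>A\<close> are left often and \<open>A\<close> still has few neighbours.\<close>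

lemma prob_all_expand_ge:
  fixes K a \<theta> \<delta> \<beta> c :: real
  assumes code: "codegree_cond K a n G" and K: "1 < K" and a: "1 \<le> a" and n: "2 \<le> n"
    and x0: "x0 \<in> V" and deg: "\<And>x. x \<in> V \<Longrightarrow> 5 * a / 6 * ln n \<le> d x"
    and \<delta>: "0 < \<delta>" "\<theta> = 8 / \<delta>" and \<beta>: "0 < \<beta>" "\<beta> \<le> \<delta> / 2"
    and small: "6/5 * (5 / ln K + 4 * K / ln n + \<beta> * K) \<le> \<theta> * exp (- \<theta>) / 4"
    and few: "\<And>v. v \<in> V \<Longrightarrow>
      measure_pmf.prob (lazy_walk G L x0) {xs. exits v (rev xs) < nat \<lceil>\<delta> * ln n\<rceil>} \<le> c"
  shows "measure_pmf.prob (lazy_walk G L x0)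
      {xs. \<forall>A. A \<subseteq> V \<longrightarrow> real (card A) \<le> real n / ln (real n) \<longrightarrow>
         real (card (mg_ext_nbhd (walk_trace xs) A)) \<ge> \<beta> * real (card A) * ln (real n)}
    \<ge> 2 - n * c - exp (1 / n)"
proof -
  define M where "M = measure_pmf (lazy_walk G L x0)"
  interpret prob_space M unfolding M_def by (rule prob_space_measure_pmf)
  have [simp]: "sets M = UNIV" "space M = UNIV" by (auto simp: M_def)
  define l where "l = ln (real n)"
  have l: "l > 0" using n by (simp add: l_def)
  have lnK: "ln K > 0" using K by simp
  define m where "m = nat \<lceil>\<delta> * l\<rceil>"
  have m: "real m \<ge> \<delta> * l" unfolding m_def by (rule of_nat_ceiling)
  have \<theta>: "\<theta> > 0" using \<delta> by simp
  define good where "good = {xs. \<forall>A. A \<subseteq> V \<longrightarrow> real (card A) \<le> real n / ln (real n) \<longrightarrow>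
         real (card (mg_ext_nbhd (walk_trace xs) A)) \<ge> \<beta> * real (card A) * ln (real n)}"
  define bad1 where "bad1 v = {xs. exits v (rev xs) < m}" for v
  define bad2 where "bad2 A = {xs. (\<forall>v\<in>A. m \<le> exits v (rev xs)) \<and>
      card (mg_ext_nbhd (walk_trace xs) A) \<le> \<beta> * card A * l}" for A
  define I where "I = {A \<in> Pow V. A \<noteq> {} \<and> card A \<le> n / l}"
  have finI: "finite I" by (simp add: I_def)
  have bad2: "prob (bad2 A) \<le> (1 / real n ^ 2) ^ card A" if "A \<in> I" for A
  proof -
    have A: "A \<subseteq> V" "A \<noteq> {}" "card A \<le> n / ln n" using that by (auto simp: I_def l_def)
    define k where "k = real (card A)"
    have k: "0 \<le> k" by (simp add: k_def)
    define q where "q = 6/5 * (5 / ln K + 4 * K / l + \<beta> * K)"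
    have q: "exp \<theta> * q \<le> \<theta> / 4"
    proof -
      have "exp \<theta> * q \<le> exp \<theta> * (\<theta> * exp (- \<theta>) / 4)"
        unfolding q_def l_def by (intro mult_left_mono small) auto
      also have "\<dots> = \<theta> / 4" by (simp add: exp_minus)
      finally show ?thesis .
    qed
    have "prob (bad2 A) \<le> exp (exp \<theta> * m * (6/5 * (5 * card A / ln K + 4 * K * card A / ln n + (\<beta> * card A * l) * K / ln n))
          - \<theta> * (m * card A - (\<beta> * card A * l)))"
      unfolding M_def bad2_def
      using \<theta> \<beta> l by (intro prob_small_neighbourhood_le[OF code K a n A x0 _ _ deg]) auto
    also have "6/5 * (5 * card A / ln K + 4 * K * card A / ln n + (\<beta> * card A * l) * K / ln n) = k * q"
      using l lnK by (simp add: q_def k_def l_def[symmetric] field_simps)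
    \<comment> \<open>The gain is at least \<open>\<theta> * m * k / 2\<close> by
      \<open>\<beta> \<le> \<delta> / 2\<close>, the rate costs at most half of it, and
      \<open>\<theta> = 8 / \<delta>\<close> makes the rest at least
      \<open>2 * l * k\<close>.\<close>
    also have "exp (exp \<theta> * m * (k * q) - \<theta> * (m * card A - (\<beta> * card A * l))) \<le> exp (- (2 * l * k))"
    proof -
      have "\<beta> * k * l \<le> \<delta> / 2 * k * l" using \<beta> k l by (intro mult_right_mono) auto
      also have "\<dots> = (\<delta> * l) * k / 2" by simp
      also have "\<dots> \<le> m * k / 2" using m k by (intro divide_right_mono mult_right_mono) auto
      finally have "m * k / 2 \<le> m * k - \<beta> * k * l" by linarith
      then have "\<theta> * (m * k / 2) \<le> \<theta> * (m * k - \<beta> * k * l)" using \<theta> by (intro mult_left_mono) auto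
      moreover have "exp \<theta> * q * (m * k) \<le> \<theta> / 4 * (m * k)" using q k by (intro mult_right_mono) auto
      moreover have "\<theta> / 4 * (\<delta> * l * k) \<le> \<theta> / 4 * (m * k)"
        using \<theta> m k by (intro mult_left_mono mult_right_mono) auto
      moreover have "\<theta> / 4 * (\<delta> * l * k) = 2 * l * k" using \<delta> by simp
      moreover have "\<theta> * (m * k / 2) = 2 * (\<theta> / 4 * (m * k))" by simp
      ultimately have "exp \<theta> * q * (m * k) - \<theta> * (m * k - \<beta> * k * l) \<le> - (2 * l * k)" by linarith
      moreover have "exp \<theta> * m * (k * q) = exp \<theta> * q * (m * k)" by simp
      ultimately have "exp \<theta> * m * (k * q) - \<theta> * (m * k - \<beta> * k * l) \<le> - (2 * l * k)" by linarith
      then show ?thesis by (simp add: k_def)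
    qed
    also have "exp (- (2 * l * k)) = exp (- (2 * l)) ^ card A"
      by (simp add: k_def exp_of_nat_mult[symmetric] mult_ac)
    also have "exp (- (2 * l)) = 1 / real n ^ 2"
      using n by (simp add: exp_minus exp_double l_def inverse_eq_divide)
    finally show ?thesis .
  qed
  have "UNIV - good \<subseteq> (\<Union>v\<in>V. bad1 v) \<union> (\<Union>A\<in>I. bad2 A)"
  proof
    fix xs assume "xs \<in> UNIV - good"
    then obtain A where A: "A \<subseteq> V" "real (card A) \<le> n / l"
      "real (card (mg_ext_nbhd (walk_trace xs) A)) < \<beta> * real (card A) * l"
      by (auto simp: good_def l_def not_le)
    then have "A \<noteq> {}" by auto
    then have "A \<in> I" using A by (simp add: I_def)
    show "xs \<in> (\<Union>v\<in>V. bad1 v) \<union> (\<Union>A\<in>I. bad2 A)"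
    proof (cases "\<forall>v\<in>A. m \<le> exits v (rev xs)")
      case True
      then have "xs \<in> bad2 A" using A by (simp add: bad2_def)
      then show ?thesis using \<open>A \<in> I\<close> by blast
    next
      case False
      then show ?thesis using A by (force simp: bad1_def)
    qed
  qed
  then have "prob (UNIV - good) \<le> prob ((\<Union>v\<in>V. bad1 v) \<union> (\<Union>A\<in>I. bad2 A))"
    by (intro finite_measure_mono) auto
  also have "\<dots> \<le> prob (\<Union>v\<in>V. bad1 v) + prob (\<Union>A\<in>I. bad2 A)"
    by (intro measure_Un_le) auto
  also have "prob (\<Union>v\<in>V. bad1 v) \<le> (\<Sum>v\<in>V. prob (bad1 v))"
    by (intro finite_measure_subadditive_finite) auto
  also have "\<dots> \<le> (\<Sum>v\<in>V. c)"
    using few by (intro sum_mono) (auto simp: M_def bad1_def m_def l_def)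
  also have "prob (\<Union>A\<in>I. bad2 A) \<le> (\<Sum>A\<in>I. prob (bad2 A))"
    using finI by (intro finite_measure_subadditive_finite) auto
  also have "\<dots> \<le> (\<Sum>A\<in>I. (1 / real n ^ 2) ^ card A)"
    by (intro sum_mono bad2)
  \<comment> \<open>The empty set expands trivially; leaving it out removes the summand 1.\<close>
  also have "\<dots> \<le> (\<Sum>A\<in>Pow V - {{}}. (1 / real n ^ 2) ^ card A)"
    by (intro sum_mono2) (auto simp: I_def)
  also have "\<dots> = (1 + 1 / real n ^ 2) ^ n - 1"
    using sum_Pow_power_card[of V "1 / real n ^ 2"] by (simp add: sum_diff1)
  also have "(1 + 1 / real n ^ 2) ^ n \<le> exp (1 / real n ^ 2) ^ n"
    by (intro power_mono exp_ge_add_one_self) auto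
  also have "exp (1 / real n ^ 2) ^ n = exp (1 / n)"
    using n by (simp add: exp_of_nat_mult[symmetric] power2_eq_square)
  finally have "prob (UNIV - good) \<le> n * c + (exp (1 / n) - 1)" by simp
  moreover have "prob (UNIV - good) = 1 - prob good"
    using prob_compl[of good] by simp
  ultimately show ?thesis by (simp add: M_def good_def)
qed

end

section \<open>Choice of the constants and passage to the limit\<close>

theorem theorem3p8:
  "\<exists>\<epsilon>0>0. \<forall>(\<epsilon>::real) (\<alpha>::nat \<Rightarrow> real) (G::nat \<Rightarrow> graph) (v0::nat \<Rightarrow> nat).
     0 < \<epsilon> \<longrightarrow> \<epsilon> < \<epsilon>0 \<longrightarrow>
     (\<forall>n. \<alpha> n \<ge> 1500 / \<epsilon>\<^sup>2) \<longrightarrow>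
     (\<forall>n. graph_on n (G n)) \<longrightarrow>
     pseudo_random \<alpha> G \<longrightarrow>
     (\<forall>n\<ge>1. v0 n \<in> {1..n}) \<longrightarrow>
     (\<exists>\<beta>>0.
        (\<lambda>n. measure_pmf.prob (lazy_walk (G n) (walk_length \<epsilon> n) (v0 n))
               {xs. \<forall>A. A \<subseteq> {1..n} \<longrightarrow> real (card A) \<le> real n / ln (real n) \<longrightarrow>
                      real (card (mg_ext_nbhd (walk_trace xs) A)) \<ge> \<beta> * real (card A) * ln (real n)})
          \<longlonglongrightarrow> 1)"
proof (rule exI[of _ "1/100"], intro conjI allI impI)
  fix \<epsilon> :: real and \<alpha> :: "nat \<Rightarrow> real" and G :: "nat \<Rightarrow> graph" and v0 :: "nat \<Rightarrow> nat"
  assume \<epsilon>: "0 < \<epsilon>" "\<epsilon> < 1/100" and \<alpha>: "\<forall>n. \<alpha> n \<ge> 1500 / \<epsilon>\<^sup>2"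
    and G: "\<forall>n. graph_on n (G n)" and pr: "pseudo_random \<alpha> G" and v0: "\<forall>n\<ge>1. v0 n \<in> {1..n}"
  have \<alpha>1: "\<alpha> n \<ge> 1" for n
  proof -
    have "\<epsilon>\<^sup>2 \<le> 1\<^sup>2" using \<epsilon> by (intro power_mono) auto
    then have "1 \<le> 1500 / \<epsilon>\<^sup>2" using \<epsilon> by (simp add: field_simps)
    then show ?thesis using \<alpha> order.trans by blast
  qed
  define w where "w = ln (40 / \<epsilon>)"
  have w: "w > 0" using \<epsilon> by (simp add: w_def)
  \<comment> \<open>With \<open>m\<close> about \<open>\<delta> * ln n\<close>, the factor
    \<open>(\<epsilon> / 40) ^ m\<close> is about \<open>n powr (- (\<epsilon> / 12))\<close>, which
    uses up half of the surplus \<open>\<epsilon> / 6\<close>.\<close>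
  define \<delta> where "\<delta> = \<epsilon> / (12 * w)"
  have \<delta>: "\<delta> > 0" using \<epsilon> w by (simp add: \<delta>_def)
  define \<theta> where "\<theta> = 8 / \<delta>"
  define q where "q = \<theta> * exp (- \<theta>) / 4"
  have q: "q > 0" using \<delta> by (simp add: q_def \<theta>_def)
  obtain K0 where K0: "\<And>K. K \<ge> K0 \<Longrightarrow> \<forall>\<^sub>F n in sequentially. codegree_cond K (\<alpha> n) n (G n)"
    using pr unfolding pseudo_random_def by blast
  \<comment> \<open>The three terms of the rate become at most \<open>5 * q / 18\<close>,
    \<open>q / 4\<close> (for large \<open>n\<close>) and \<open>q / 4\<close> (by the choice of
    \<open>\<beta>\<close>); \<open>6/5\<close> times their sum is
    \<open>14 * q / 15\<close>.\<close>
  define K where "K = max K0 (max 2 (exp (18 / q)))"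
  have K: "K > 1" "K \<ge> K0" by (auto simp: K_def)
  have "exp (18 / q) \<le> K" by (simp add: K_def)
  then have lnK: "18 / q \<le> ln K" using K by (simp add: ln_ge_iff)
  define \<beta> where "\<beta> = min (\<delta> / 2) (q / (4 * K))"
  have \<beta>: "0 < \<beta>" "\<beta> \<le> \<delta> / 2" using \<delta> q K by (auto simp: \<beta>_def)
  have "\<beta> \<le> q / (4 * K)" by (simp add: \<beta>_def)
  then have \<beta>K: "\<beta> * K \<le> q / 4" using K by (simp add: field_simps)
  have qK: "5 / ln K \<le> 5 * q / 18"
  proof -
    have "0 < 18 / q" using q by simp
    then have "5 / ln K \<le> 5 / (18 / q)" using lnK by (intro frac_le) auto
    then show ?thesis by simp
  qed
  \<comment> \<open>The isolated \<open>\<epsilon> / 40\<close> in the denominator accounts for the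
    ceiling in \<open>m\<close>.\<close>
  define C where "C n = exp 1 * real n powr (- (1 + \<epsilon> / 6)) / (2 * (\<epsilon> / 40 * real n powr (- (\<epsilon> / 12))))" for n
  define P where "P = (\<lambda>n. measure_pmf.prob (lazy_walk (G n) (walk_length \<epsilon> n) (v0 n))
               {xs. \<forall>A. A \<subseteq> {1..n} \<longrightarrow> real (card A) \<le> real n / ln (real n) \<longrightarrow>
                      real (card (mg_ext_nbhd (walk_trace xs) A)) \<ge> \<beta> * real (card A) * ln (real n)})"
  have ev1: "\<forall>\<^sub>F n in sequentially. 1 \<le> ln (real n)" by real_asymp
  have ev2: "\<forall>\<^sub>F n in sequentially. 40 \<le> \<epsilon> * real n ^ 3" using \<epsilon> by real_asymp
  have ev3: "\<forall>\<^sub>F n in sequentially. 4 * K / ln (real n) \<le> q / 4" using q by real_asymp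
  have lower: "\<forall>\<^sub>F n in sequentially. 2 - n * C n - exp (1 / n) \<le> P n"
    using pr[unfolded pseudo_random_def, THEN conjunct1] K0[OF K(2)] ev1 ev2 ev3 eventually_ge_at_top[of 2]
  proof eventually_elim
    case (elim n)
    have lpos: "ln (real n) > 0" using elim by simp
    have degc: "degree_cond (\<alpha> n) n (G n)" using elim by blast
    \<comment> \<open>Degrees are known to be positive only for large \<open>n\<close>, so the
      locale is entered inside the eventual statement.\<close>
    interpret walk_graph n "G n"
    proof
      show "graph_on n (G n)" using G by blast
      fix v assume "v \<in> {1..n}"
      then have "5 * \<alpha> n / 6 * ln (real n) \<le> real (deg (G n) v)" using degc by (simp add: degree_cond_def)
      moreover have "0 < 5 * \<alpha> n / 6 * ln (real n)" using \<alpha>1[of n] lpos by simp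
      ultimately show "0 < deg (G n) v" by linarith
    qed
    show ?case
      unfolding P_def
    proof (rule prob_all_expand_ge[where K = K and a = "\<alpha> n" and \<theta> = \<theta> and \<delta> = \<delta>])
      show "6/5 * (5 / ln K + 4 * K / ln n + \<beta> * K) \<le> \<theta> * exp (- \<theta>) / 4"
        using qK \<beta>K elim q by (simp add: q_def[symmetric])
      show "5 * \<alpha> n / 6 * ln n \<le> d x" if "x \<in> V" for x
        using degc that by (simp add: degree_cond_def)
      fix v assume v: "v \<in> V"
      define m where "m = nat \<lceil>\<delta> * ln (real n)\<rceil>"
      have "measure_pmf.prob (lazy_walk (G n) (walk_length \<epsilon> n) (v0 n)) {xs. exits v (rev xs) < m}
          \<le> exp 1 * real n powr (- (1 + \<epsilon> / 6)) / (2 * (\<epsilon> / 40) ^ m)"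
        using elim \<epsilon> \<alpha> v v0 by (intro prob_exits_less_le[where a = "\<alpha> n"]) auto
      also have "\<dots> \<le> C n"
        unfolding C_def
      proof (intro divide_left_mono mult_left_mono)
        have "real m \<le> \<delta> * ln n + 1" using \<delta> lpos by (simp add: m_def)
        then have "w * real m \<le> w * (\<delta> * ln n + 1)" using w by (intro mult_left_mono) auto
        also have "\<dots> = \<epsilon> / 12 * ln n + w" using w by (simp add: \<delta>_def field_simps)
        finally have "exp (- w - \<epsilon> / 12 * ln n) \<le> exp (- (w * real m))" by simp
        also have "exp (- (w * real m)) = exp (- w) ^ m"
          by (simp add: exp_of_nat_mult[symmetric] mult.commute)
        finally have "exp (- w) * exp (- (\<epsilon> / 12 * ln n)) \<le> exp (- w) ^ m"
          by (simp add: exp_add[symmetric])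
        moreover have "exp (- w) = \<epsilon> / 40" using \<epsilon> by (simp add: w_def exp_minus)
        moreover have "exp (- (\<epsilon> / 12 * ln n)) = real n powr (- (\<epsilon> / 12))"
          using elim by (simp add: powr_def)
        ultimately show "\<epsilon> / 40 * real n powr (- (\<epsilon> / 12)) \<le> (\<epsilon> / 40) ^ m" by simp
      qed (use \<epsilon> elim in auto)
      finally show "measure_pmf.prob (lazy_walk (G n) (walk_length \<epsilon> n) (v0 n))
          {xs. exits v (rev xs) < nat \<lceil>\<delta> * ln n\<rceil>} \<le> C n" by (simp add: m_def)
    qed (use elim K \<alpha>1 v0 \<delta> \<beta> in \<open>auto simp: \<theta>_def\<close>)
  qed
  \<comment> \<open>Here \<open>n * C n\<close> is a constant times
    \<open>n powr (- (\<epsilon> / 12))\<close>.\<close>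
  have "(\<lambda>n. 2 - n * C n - exp (1 / n)) \<longlonglongrightarrow> 1"
    unfolding C_def using \<epsilon> by real_asymp
  moreover have "\<forall>\<^sub>F n in sequentially. P n \<le> 1" by (simp add: P_def)
  ultimately have "P \<longlonglongrightarrow> 1" using lower by (intro tendsto_sandwich[of _ P _ "\<lambda>_. 1"]) auto
  then show "\<exists>\<beta>>0.
        (\<lambda>n. measure_pmf.prob (lazy_walk (G n) (walk_length \<epsilon> n) (v0 n))
               {xs. \<forall>A. A \<subseteq> {1..n} \<longrightarrow> real (card A) \<le> real n / ln (real n) \<longrightarrow>
                      real (card (mg_ext_nbhd (walk_trace xs) A)) \<ge> \<beta> * real (card A) * ln (real n)})
          \<longlonglongrightarrow> 1"
    using \<beta>(1) unfolding P_def by blast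
qed simp

end
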